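(* Let $\mathcal W_t=\{w_t\in\mathbb C^{N\times 1}:\|w_t\|=1\}$ and $\mathcal W_r=\{w_r\in\mathbb C^{1\times N}:\|w_r\|=1\}$. For $w_r\in\mathcal W_r$, $w_t\in\mathcal W_t$ define the random variable $$\Gamma(w_r,w_t)=\frac{\frac{\eta\theta(1-\theta)\rho^2}{d_1^{2\tau}d_2^{\tau}}\,\|h_1\|^2\,|w_rh_1|^2\,|h_2w_t|^2}{\frac{\eta\theta\rho}{d_1^{\tau}d_2^{\tau}}\,\|h_1\|^2\,|h_2w_t|^2+\frac{(1-\theta)\rho}{d_1^{\tau}}\,|w_rh_1|^2+1}$$ and the ergodic capacity $C(w_r,w_t)=\tfrac12 E\{\log_2(1+\Gamma(w_r,w_t))\}$. Then $C$ is maximized over $\mathcal W_r\times\mathcal W_t$ by taking $w_t$ to be a unit eigenvector of $R_t$ associated with its largest eigenvalue $\sigma_1$, and $w_r=u_r^H$ where $u_r$ is a unit eigenvector of $R_r$ associated with its largest eigenvalue $\lambda_1$.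
   Context: Fix an integer $N\ge 1$ and constants $\eta\in(0,1]$, $\theta\in(0,1)$, $\rho>0$, $d_1,d_2>0$, $\tau>0$. Let $R_r,R_t$ be $N\times N$ Hermitian positive definite matrices with eigenvalues $\lambda_1\ge\dots\ge\lambda_N>0$ and $\sigma_1\ge\dots\ge\sigma_N>0$ respectively, and $R^{1/2}$ denotes the Hermitian positive definite square root. Let $h_{w1}\in\mathbb C^{N\times1}$ and $h_{w2}\in\mathbb C^{1\times N}$ be independent random vectors with i.i.d. zero-mean circularly symmetric complex Gaussian entries of unit variance, and set $h_1=R_r^{1/2}h_{w1}$ (an $N\times1$ vector) and $h_2=h_{w2}R_t^{1/2}$ (a $1\times N$ vector). $\|\cdot\|$ is the Euclidean norm. (This models a rank-one relay processing matrix $\omega w_tw_r$ in a dual-hop power-splitting energy-harvesting relay with only statistical CSI.) *)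

theory Defs
  imports "HOL-Analysis.Analysis" "HOL-Probability.Probability"
begin

text \<open>N x N complex matrices are modelled as complex^'n^'n with a finite index type 'n
  (so N = CARD('n) \<ge> 1). Column and row vectors are both modelled as complex^'n.\<close>

definition conj_transpose :: "complex^'n^'n \<Rightarrow> complex^'n^'n" where
  "conj_transpose A = (\<chi> i j. cnj (A $ j $ i))"

definition hermitian :: "complex^'n^'n \<Rightarrow> bool" where
  "hermitian A \<longleftrightarrow> conj_transpose A = A"

definition qform :: "complex^'n^'n \<Rightarrow> complex^'n \<Rightarrow> complex" where
  "qform A x = (\<Sum>i\<in>UNIV. cnj (x $ i) * (A *v x) $ i)"

definition hermitian_posdef :: "complex^'n^'n \<Rightarrow> bool" where
  "hermitian_posdef A \<longleftrightarrow> hermitian A \<and> (\<forall>x. x \<noteq> 0 \<longrightarrow> Re (qform A x) > 0)"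

definition hpd_sqrt :: "complex^'n^'n \<Rightarrow> complex^'n^'n" where
  "hpd_sqrt R = (THE S. hermitian_posdef S \<and> S ** S = R)"

definition is_eigenvalue :: "complex^'n^'n \<Rightarrow> complex \<Rightarrow> bool" where
  "is_eigenvalue A \<mu> \<longleftrightarrow> (\<exists>v. v \<noteq> 0 \<and> A *v v = \<mu> *s v)"

definition unit_top_eigvec :: "complex^'n^'n \<Rightarrow> complex^'n \<Rightarrow> bool" where
  "unit_top_eigvec A u \<longleftrightarrow> norm u = 1 \<and>
     (\<exists>lam::real. A *v u = complex_of_real lam *s u \<and>
        (\<forall>\<mu>. is_eigenvalue A \<mu> \<longrightarrow> Re \<mu> \<le> lam))"

definition rowcol :: "complex^'n \<Rightarrow> complex^'n \<Rightarrow> complex" where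
  "rowcol w h = (\<Sum>i\<in>UNIV. w $ i * h $ i)"

definition herm_vec :: "complex^'n \<Rightarrow> complex^'n" where
  "herm_vec u = (\<chi> i. cnj (u $ i))"

text \<open>Distribution CN(0, I_N) on C^N: i.i.d. zero-mean circularly symmetric complex Gaussian
  entries of unit variance; density pi^(-N) exp(-||x||^2) w.r.t. Lebesgue measure on C^N = R^(2N).\<close>
definition cgauss :: "(complex^'n) measure" where
  "cgauss = density lborel (\<lambda>x. ennreal (exp (- (norm x)\<^sup>2) / pi ^ CARD('n)))"

definition Gamma ::
  "real \<Rightarrow> real \<Rightarrow> real \<Rightarrow> real \<Rightarrow> real \<Rightarrow> real \<Rightarrow> complex^'n^'n \<Rightarrow> complex^'n^'n \<Rightarrow>
   complex^'n \<Rightarrow> complex^'n \<Rightarrow> complex^'n \<Rightarrow> complex^'n \<Rightarrow> real" where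
  "Gamma \<eta> \<theta> \<rho> d1 d2 \<tau> Rr Rt wr wt hw1 hw2 =
     (let h1 = hpd_sqrt Rr *v hw1;
          h2 = hw2 v* hpd_sqrt Rt;
          A = (norm h1)^2; B = (cmod (rowcol wr h1))^2; G = (cmod (rowcol h2 wt))^2
      in ((\<eta> * \<theta> * (1 - \<theta>) * \<rho>^2 / (d1 powr (2 * \<tau>) * d2 powr \<tau>)) * A * B * G) /
         ((\<eta> * \<theta> * \<rho> / (d1 powr \<tau> * d2 powr \<tau>)) * A * G
          + ((1 - \<theta>) * \<rho> / d1 powr \<tau>) * B + 1))"

definition ergodic_capacity ::
  "real \<Rightarrow> real \<Rightarrow> real \<Rightarrow> real \<Rightarrow> real \<Rightarrow> real \<Rightarrow> complex^'n^'n \<Rightarrow> complex^'n^'n \<Rightarrow>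
   complex^'n \<Rightarrow> complex^'n \<Rightarrow> real" where
  "ergodic_capacity \<eta> \<theta> \<rho> d1 d2 \<tau> Rr Rt wr wt =
     1/2 * (\<integral>hh. log 2 (1 + Gamma \<eta> \<theta> \<rho> d1 d2 \<tau> Rr Rt wr wt (fst hh) (snd hh))
              \<partial>(cgauss \<Otimes>\<^sub>M cgauss))"

end

theory Submission
  imports Defs
begin

text \<open>With \<open>p = \<beta> \<parallel>h\<^sub>1\<parallel>\<^sup>2 |h\<^sub>2 w\<^sub>t|\<^sup>2\<close> and \<open>q = \<gamma> |w\<^sub>r h\<^sub>1|\<^sup>2\<close> one has
  \<open>1 + \<Gamma> = (1 + p) (1 + q) / (1 + p + q)\<close>, hence
  \<open>ln (1 + \<Gamma>) = \<integral>\<^bsub>s>0\<^esub> (e\<^bsup>-s\<^esup> / s) (1 - e\<^bsup>-sp\<^esup>) (1 - e\<^bsup>-sq\<^esup>) ds\<close>, and by Tonelli it suffices to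
  compare \<open>E (1 - e\<^bsup>-sp\<^esup>) (1 - e\<^bsup>-sq\<^esup>)\<close> for each \<open>s\<close>. Averaging over \<open>h\<^sub>2\<close> alone, this
  increases with \<open>w\<^sub>t\<^sup>H R\<^sub>t w\<^sub>t\<close>, which settles \<open>w\<^sub>t\<close>. For \<open>w\<^sub>r\<close>, fix \<open>h\<^sub>2\<close> and write \<open>R\<close> for \<open>R\<^sub>r\<close>
  and \<open>w\<close> for \<open>w\<^sub>r\<^sup>H\<close>. The joint Laplace transform of \<open>A = \<parallel>h\<^sub>1\<parallel>\<^sup>2\<close> and \<open>B = |w\<^sub>r h\<^sub>1|\<^sup>2\<close> is
  \<open>E e\<^bsup>-sA-tB\<^esup> = D(s) / (1 + t m)\<close> with \<open>D(s) = E e\<^bsup>-sA\<^esup>\<close> and \<open>m = w\<^sup>H R (1 + s R)\<^sup>-\<^sup>1 w\<close>. The bounds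
  \<open>D(s) \<le> 1 / (1 + s \<lambda>\<^sub>1)\<close> and \<open>m \<ge> w\<^sup>H R w / (1 + s \<lambda>\<^sub>1)\<close> then give
  \<open>E (1 - e\<^bsup>-sA\<^esup>) (1 - e\<^bsup>-tB\<^esup>) \<le>\<close> the value at the top eigenvector, where both are explicit.\<close>

subsection \<open>Hermitian forms and positive definite square roots\<close>

text \<open>The inner product of \<open>complex^'n\<close> is only the real part of this form. The
  full value is needed for moduli and for complex rank-one matrices; the first argument is the
  conjugated one.\<close>

definition cdot :: "complex^'n \<Rightarrow> complex^'n \<Rightarrow> complex" where
  "cdot x y = (\<Sum>i\<in>UNIV. cnj (x $ i) * y $ i)"

lemma inner_eq_Re_cdot: "x \<bullet> y = Re (cdot x y)"
  by (simp add: cdot_def inner_vec_def inner_complex_def)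

lemma cdot_add_right: "cdot x (y + z) = cdot x y + cdot x z"
  by (simp add: cdot_def algebra_simps sum.distrib)

lemma cdot_diff_right: "cdot x (y - z) = cdot x y - cdot x z"
  by (simp add: cdot_def algebra_simps sum_subtractf)

lemma cdot_smult_right: "cdot x (c *s y) = c * cdot x y"
  by (simp add: cdot_def sum_distrib_left algebra_simps)

lemma cdot_scaleR_left: "cdot (r *\<^sub>R x) y = of_real r * cdot x y"
  by (simp add: cdot_def scaleR_conv_of_real[where 'a=complex] sum_distrib_left algebra_simps)

lemma cnj_cdot: "cnj (cdot x y) = cdot y x"
  by (simp add: cdot_def algebra_simps)

lemma cdot_smult_left: "cdot (c *s x) y = cnj c * cdot x y"
  by (simp add: cdot_def sum_distrib_left algebra_simps)

lemma cdot_self: "cdot x x = of_real ((norm x)\<^sup>2)"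
proof -
  have "Im (cdot x x) = 0" using cnj_cdot[of x x] by (metis complex_cnj_cancel_iff Reals_cnj_iff complex_is_Real_iff)
  moreover have "Re (cdot x x) = (norm x)\<^sup>2"
    by (simp add: inner_eq_Re_cdot[symmetric] power2_norm_eq_inner)
  ultimately show ?thesis by (simp add: complex_eq_iff)
qed

lemma norm_smult: "norm (c *s (x::complex^'n)) = cmod c * norm x"
proof -
  have "of_real ((norm (c *s x))\<^sup>2) = (of_real ((cmod c * norm x)\<^sup>2) :: complex)"
    unfolding cdot_self[symmetric] cdot_smult_left cdot_smult_right
    by (simp only: cdot_self power_mult_distrib of_real_mult complex_norm_square[of c] mult_ac)
  then show ?thesis
    by (metis mult_nonneg_nonneg norm_ge_zero of_real_eq_iff power2_eq_iff_nonneg)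
qed

text \<open>Multiplying \<open>y\<close> by a unimodular phase makes the form real and non-negative,
  and the real Cauchy-Schwarz inequality applies.\<close>

lemma cmod_cdot_le: "cmod (cdot x y) \<le> norm x * norm y"
proof (cases "cdot x y = 0")
  case False
  define c where "c = cnj (sgn (cdot x y))"
  have "c * cdot x y = of_real (cmod (cdot x y))"
    using False unfolding c_def
    using complex_norm_square[of "cdot x y"]
    by (simp add: sgn_eq divide_eq_eq mult.commute power2_eq_square)
  then have "cmod (cdot x y) = x \<bullet> (c *s y)"
    by (simp add: inner_eq_Re_cdot cdot_smult_right)
  also have "\<dots> \<le> norm x * norm (c *s y)" by (rule norm_cauchy_schwarz)
  also have "norm (c *s y) = norm y"
    using False by (simp add: norm_smult c_def norm_sgn)
  finally show ?thesis .
qed simp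

lemma hermitian_cdot:
  assumes "hermitian A"
  shows "cdot x (A *v y) = cdot (A *v x) y"
proof -
  have A: "cnj (A $ j $ i) = A $ i $ j" for i j
    using assms unfolding hermitian_def conj_transpose_def by (metis vec_lambda_beta)
  have "cdot x (A *v y) = (\<Sum>i\<in>UNIV. \<Sum>j\<in>UNIV. cnj (x$i) * (A$i$j * y$j))"
    by (simp add: cdot_def matrix_vector_mult_def sum_distrib_left)
  also have "\<dots> = (\<Sum>j\<in>UNIV. \<Sum>i\<in>UNIV. cnj (x$i) * (A$i$j * y$j))"
    by (rule sum.swap)
  also have "\<dots> = cdot (A *v x) y"
    by (simp add: cdot_def matrix_vector_mult_def sum_distrib_left sum_distrib_right A algebra_simps)
  finally show ?thesis .
qed

lemma hermitian_inner: "hermitian A \<Longrightarrow> x \<bullet> (A *v y) = (A *v x) \<bullet> y"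
  by (simp add: inner_eq_Re_cdot hermitian_cdot)

lemma qform_eq_cdot: "qform A x = cdot x (A *v x)"
  by (simp add: qform_def cdot_def)

lemma hermitian_posdef_iff:
  "hermitian_posdef A \<longleftrightarrow> hermitian A \<and> (\<forall>x. x \<noteq> 0 \<longrightarrow> 0 < x \<bullet> (A *v x))"
  by (simp add: hermitian_posdef_def qform_eq_cdot inner_eq_Re_cdot)

lemma scaleR_eq_smult: "r *\<^sub>R (x::complex^'n) = complex_of_real r *s x"
  by (simp add: vec_eq_iff scaleR_conv_of_real[where 'a=complex])

lemma cmatrix_vector_mult_scaleR: "(A::complex^'n^'n) *v (r *\<^sub>R x) = r *\<^sub>R (A *v x)"
  by (simp add: scaleR_eq_smult vec.scale)

lemma linear_matrix_vector_mult: "linear (\<lambda>x. (A::complex^'n^'n) *v x)"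
  by (intro linearI matrix_vector_right_distrib cmatrix_vector_mult_scaleR)

lemma continuous_matrix_vector_mult:
  fixes f :: "'a::euclidean_space \<Rightarrow> complex^'n"
  shows "continuous_on X f \<Longrightarrow> continuous_on X (\<lambda>x. (A::complex^'n^'n) *v f x)"
  by (rule linear_continuous_on_compose[OF _ linear_matrix_vector_mult])

text \<open>The Rayleigh quotient attains its maximum on the compact unit sphere, and stationarity
  in the direction of the residual \<open>A *v v - \<mu> *\<^sub>R v\<close> forces that residual to
  vanish.\<close>

lemma hermitian_top_eigenvector:
  fixes A :: "complex^'n^'n"
  assumes "hermitian A"
  obtains v :: "complex^'n" and \<mu> :: real
  where "norm v = 1" "A *v v = \<mu> *\<^sub>R v" "\<And>x. x \<bullet> (A *v x) \<le> \<mu> * (norm x)\<^sup>2"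
proof -
  let ?f = "\<lambda>x::complex^'n. x \<bullet> (A *v x)"
  have "continuous_on (sphere 0 1) ?f"
    by (intro continuous_intros continuous_matrix_vector_mult)
  moreover have "sphere (0::complex^'n) 1 \<noteq> {}" by simp
  ultimately obtain v where v: "v \<in> sphere 0 1" "\<And>x. x \<in> sphere 0 1 \<Longrightarrow> ?f x \<le> ?f v"
    using continuous_attains_sup[of "sphere 0 1" ?f] by auto
  define \<mu> where "\<mu> = ?f v"
  have nv: "norm v = 1" using v(1) by simp
  have top: "?f x \<le> \<mu> * (norm x)\<^sup>2" for x
  proof (cases "x = 0")
    case False
    have "?f (x /\<^sub>R norm x) \<le> \<mu>" unfolding \<mu>_def using False by (intro v(2)) simp
    then have "?f x / (norm x)\<^sup>2 \<le> \<mu>"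
      by (simp add: cmatrix_vector_mult_scaleR power2_eq_square divide_inverse mult_ac)
    with False show ?thesis by (simp add: field_simps)
  qed simp
  define w where "w = A *v v - \<mu> *\<^sub>R v"
  define c where "c = \<mu> * (norm w)\<^sup>2 - ?f w"
  \<comment> \<open>The maximum property at \<open>v + t *\<^sub>R w\<close>, expanded in
    \<open>t\<close>: the constant terms cancel.\<close>
  have key: "2 * t * (norm w)\<^sup>2 \<le> t\<^sup>2 * c" for t :: real
  proof -
    have wv: "v \<bullet> (A *v w) = w \<bullet> (A *v v)"
      using hermitian_inner[OF assms, of v w] by (simp add: inner_commute)
    have "?f (v + t *\<^sub>R w) = \<mu> + 2 * t * (w \<bullet> (A *v v)) + t\<^sup>2 * ?f w"
      by (simp add: matrix_vector_right_distrib cmatrix_vector_mult_scaleR inner_add_left inner_add_right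
          wv \<mu>_def power2_eq_square algebra_simps)
    moreover have "(norm (v + t *\<^sub>R w))\<^sup>2 = 1 + 2 * t * (w \<bullet> v) + t\<^sup>2 * (norm w)\<^sup>2"
      using nv unfolding power2_norm_eq_inner
      by (simp add: inner_add_left inner_add_right inner_commute power2_eq_square algebra_simps norm_eq_1)
    moreover have "(norm w)\<^sup>2 = w \<bullet> (A *v v) - \<mu> * (w \<bullet> v)"
      unfolding power2_norm_eq_inner by (subst (2) w_def) (simp add: inner_diff_right)
    moreover note top[of "v + t *\<^sub>R w"]
    ultimately have "\<mu> + 2 * t * (w \<bullet> (A *v v)) + t\<^sup>2 * ?f w \<le> \<mu> * (1 + 2 * t * (w \<bullet> v) + t\<^sup>2 * (norm w)\<^sup>2)"
      and "w \<bullet> (A *v v) = (norm w)\<^sup>2 + \<mu> * (w \<bullet> v)" by simp_all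
    then show ?thesis unfolding c_def by (simp add: algebra_simps)
  qed
  have "(norm w)\<^sup>2 = 0"
  proof (rule ccontr)
    assume "(norm w)\<^sup>2 \<noteq> 0"
    then have pos: "(norm w)\<^sup>2 > 0" by simp
    have "2 * (norm w)\<^sup>2 \<le> c" using key[of 1] by simp
    then have "c > 0" using pos by linarith
    \<comment> \<open>This \<open>t\<close> makes the right side of \<open>key\<close> half of its
      left side.\<close>
    then have "2 * (norm w)\<^sup>2 / c * (norm w)\<^sup>2 \<le> ((norm w)\<^sup>2 / c)\<^sup>2 * c"
      using key[of "(norm w)\<^sup>2 / c"] by simp
    also have "\<dots> = (norm w)\<^sup>2 / c * (norm w)\<^sup>2" using \<open>c > 0\<close> by (simp add: power2_eq_square)
    finally show False using pos \<open>c > 0\<close> by (simp add: field_simps)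
  qed
  then have "A *v v = \<mu> *\<^sub>R v" by (simp add: w_def)
  with nv top that show ?thesis by blast
qed

text \<open>\<open>unit_top_eigvec\<close> bounds only the eigenvalues. The maximum of the Rayleigh
  quotient is itself an eigenvalue, so the bound extends to the whole form.\<close>

lemma unit_top_eigvecE:
  assumes "hermitian A" "unit_top_eigvec A u"
  obtains lam :: real where "A *v u = lam *\<^sub>R u" "\<And>x. x \<bullet> (A *v x) \<le> lam * (norm x)\<^sup>2"
proof -
  obtain lam :: real where lam: "A *v u = complex_of_real lam *s u"
      "\<And>\<mu>. is_eigenvalue A \<mu> \<Longrightarrow> Re \<mu> \<le> lam"
    using assms(2) unfolding unit_top_eigvec_def by blast
  obtain v \<mu> where v: "norm v = 1" "A *v v = \<mu> *\<^sub>R v" "\<And>x. x \<bullet> (A *v x) \<le> \<mu> * (norm x)\<^sup>2"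
    using hermitian_top_eigenvector[OF assms(1)] by blast
  have "is_eigenvalue A (of_real \<mu>)" unfolding is_eigenvalue_def
    using v(1,2) by (metis norm_zero scaleR_eq_smult zero_neq_one)
  then have "\<mu> \<le> lam" using lam(2) by fastforce
  then have "x \<bullet> (A *v x) \<le> lam * (norm x)\<^sup>2" for x
    using v(3)[of x] mult_right_mono[of \<mu> lam "(norm x)\<^sup>2"] by simp
  with lam(1) that[of lam] show ?thesis by (simp add: scaleR_eq_smult)
qed

section \<open>Existence and uniqueness of the positive definite square root\<close>

definition outer :: "complex^'n \<Rightarrow> complex^'n^'n" where
  "outer v = (\<chi> i j. v $ i * cnj (v $ j))"

lemma outer_mult: "outer v *v x = cdot v x *s v"
  by (simp add: outer_def cdot_def vec_eq_iff matrix_vector_mult_def sum_distrib_right sum_distrib_left algebra_simps)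

lemma hermitian_zero: "hermitian 0"
  by (simp add: hermitian_def conj_transpose_def vec_eq_iff)

lemma hermitian_add: "hermitian A \<Longrightarrow> hermitian B \<Longrightarrow> hermitian (A + B)"
  by (simp add: hermitian_def conj_transpose_def vec_eq_iff)

lemma hermitian_diff: "hermitian A \<Longrightarrow> hermitian B \<Longrightarrow> hermitian (A - B)"
  by (simp add: hermitian_def conj_transpose_def vec_eq_iff)

lemma hermitian_scaleR_outer: "hermitian (r *\<^sub>R outer v)"
  by (simp add: hermitian_def conj_transpose_def vec_eq_iff outer_def mult.commute)

lemma scaleR_matrix_vector_mult: "(r *\<^sub>R (A::complex^'n^'n)) *v x = r *\<^sub>R (A *v x)"
  by (simp add: vec_eq_iff matrix_vector_mult_def scaleR_sum_right)

text \<open>The form at \<open>x + A *v x\<close> reduces to its cross terms, which are twice the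
  squared norm of \<open>A *v x\<close>.\<close>

lemma hermitian_eq_zeroI:
  assumes "hermitian A" "\<And>x. x \<bullet> (A *v x) = 0"
  shows "A = 0"
proof -
  have "A *v x = 0" for x
  proof -
    have "0 = (x + A *v x) \<bullet> (A *v (x + A *v x))" using assms(2) by simp
    also have "\<dots> = 2 * ((A *v x) \<bullet> (A *v x))"
      using assms(2)[of x] assms(2)[of "A *v x"] hermitian_inner[OF assms(1), of x "A *v x"]
      by (simp add: matrix_vector_right_distrib inner_add_left inner_add_right)
    finally show ?thesis by simp
  qed
  then show ?thesis by (simp add: matrix_eq)
qed

text \<open>Deflation: removing the top spectral component enlarges the kernel.\<close>
lemma psd_sqrt_exists:
  fixes A :: "complex^'n^'n"
  assumes "hermitian A" "\<And>x. 0 \<le> x \<bullet> (A *v x)"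
  shows "\<exists>S. hermitian S \<and> (\<forall>x. 0 \<le> x \<bullet> (S *v x)) \<and> S ** S = A \<and> (\<forall>x. A *v x = 0 \<longrightarrow> S *v x = 0)"
  using assms
proof (induction A rule: measure_induct_rule[of "\<lambda>A. DIM(complex^'n) - dim {x. A *v x = 0}"])
  case (less A)
  obtain v \<mu> where v: "norm v = 1" "A *v v = \<mu> *\<^sub>R v" "\<And>x. x \<bullet> (A *v x) \<le> \<mu> * (norm x)\<^sup>2"
    using hermitian_top_eigenvector[OF less.prems(1)] by blast
  have vv: "cdot v v = 1" using v(1) by (simp add: cdot_self)
  have "\<mu> \<ge> 0" using less.prems(2)[of v] v(1,2) by (simp add: norm_eq_1)
  show ?case
  proof (cases "\<mu> = 0")
    case True
    then have "A = 0" using v(3) less.prems by (intro hermitian_eq_zeroI) (auto intro: antisym)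
    then show ?thesis by (intro exI[of _ 0]) (simp add: hermitian_zero)
  next
    case False
    define A' where "A' = A - \<mu> *\<^sub>R outer v"
    have A'mult: "A' *v x = A *v x - (of_real \<mu> * cdot v x) *s v" for x
      by (simp add: A'_def matrix_vector_mult_diff_rdistrib scaleR_matrix_vector_mult outer_mult
          scaleR_eq_smult vector_smult_assoc)
    have h': "hermitian A'" unfolding A'_def
      by (intro hermitian_diff less.prems hermitian_scaleR_outer)
    have vA: "cdot v (A *v x) = of_real \<mu> * cdot v x" for x
      by (simp add: hermitian_cdot[OF less.prems(1)] v(2) cdot_scaleR_left)
    have psd': "0 \<le> x \<bullet> (A' *v x)" for x
    proof -
      \<comment> \<open>\<open>?y\<close> is the component of \<open>x\<close> orthogonal to
        \<open>v\<close>. Since \<open>A'\<close> kills \<open>v\<close> and maps into its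
        complement, its form at \<open>x\<close> is that of \<open>A\<close> at
        \<open>?y\<close>.\<close>
      let ?y = "x - cdot v x *s v"
      have Ay: "A *v ?y = A' *v x"
        by (simp add: A'mult matrix_vector_mult_diff_distrib vec.scale v(2) scaleR_eq_smult mult.commute vector_smult_assoc)
      have "cdot v (A' *v x) = 0"
        by (simp add: A'mult cdot_diff_right cdot_smult_right vv vA)
      then have "cdot ?y (A *v ?y) = cdot x (A' *v x)"
        unfolding Ay using cnj_cdot
        by (metis cdot_diff_right cdot_smult_right diff_zero mult_zero_right complex_cnj_zero)
      then show ?thesis using less.prems(2)[of ?y] by (simp add: inner_eq_Re_cdot)
    qed
    \<comment> \<open>As \<open>\<mu>\<close> is nonzero, the kernel of \<open>A\<close> is
      orthogonal to \<open>v\<close> and so lies in the kernel of \<open>A'\<close>; the inclusion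
      is strict because \<open>v\<close> itself is new.\<close>
    have ker: "A *v x = 0 \<Longrightarrow> cdot v x = 0" for x
      using vA[of x] False by (simp add: cdot_def)
    have v': "A' *v v = 0" by (simp add: A'mult v(2) vv scaleR_eq_smult)
    have sub: "subspace {x. B *v x = 0}" for B :: "complex^'n^'n"
      by (rule subspaceI) (auto simp: matrix_vector_right_distrib cmatrix_vector_mult_scaleR)
    have "v \<noteq> 0" using v(1) by auto
    have "{x. A *v x = 0} \<subset> {x. A' *v x = 0}"
    proof
      show "{x. A *v x = 0} \<subseteq> {x. A' *v x = 0}" using ker by (auto simp: A'mult)
      show "{x. A *v x = 0} \<noteq> {x. A' *v x = 0}" 
      proof
        assume "{x. A *v x = 0} = {x. A' *v x = 0}"
        then have "A *v v = 0" using v' by blast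
        then show False using v(2) False \<open>v \<noteq> 0\<close> by simp
      qed
    qed
    then have "dim {x. A *v x = 0} < dim {x. A' *v x = 0}"
      using sub by (metis dim_psubset span_eq_iff)
    moreover have "dim {x. A' *v x = 0} \<le> DIM(complex^'n)" by (rule dim_subset_UNIV)
    ultimately have "DIM(complex^'n) - dim {x. A' *v x = 0} < DIM(complex^'n) - dim {x. A *v x = 0}"
      by linarith
    from less.IH[OF this h' psd'] obtain S' where S': "hermitian S'" "\<And>x. 0 \<le> x \<bullet> (S' *v x)" "S' ** S' = A'"
        "\<And>x. A' *v x = 0 \<Longrightarrow> S' *v x = 0"
      by blast
    define S where "S = S' + sqrt \<mu> *\<^sub>R outer v"
    have Smult: "S *v x = S' *v x + (of_real (sqrt \<mu>) * cdot v x) *s v" for x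
      by (simp add: S_def matrix_vector_mult_add_rdistrib scaleR_matrix_vector_mult outer_mult
          scaleR_eq_smult vector_smult_assoc)
    \<comment> \<open>The kernel clause of the induction serves this step: \<open>A'\<close> kills
      \<open>v\<close>, so \<open>S'\<close> does too, and no mixed terms survive in
      \<open>S ** S\<close>.\<close>
    have S'v: "S' *v v = 0" using S'(4) v' by blast
    have vS': "cdot v (S' *v x) = 0" for x
      using hermitian_cdot[OF S'(1), of v x] by (simp add: S'v cdot_def)
    have "hermitian S" unfolding S_def by (intro hermitian_add S' hermitian_scaleR_outer)
    moreover have "0 \<le> x \<bullet> (S *v x)" for x
    proof -
      have "cdot x v * cdot v x = of_real ((cmod (cdot v x))\<^sup>2)"
        by (simp only: cnj_cdot[symmetric, of v x] complex_norm_square) (simp add: mult.commute)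
      then have "x \<bullet> ((of_real (sqrt \<mu>) * cdot v x) *s v) = sqrt \<mu> * (cmod (cdot v x))\<^sup>2"
        by (simp add: inner_eq_Re_cdot cdot_smult_right mult.assoc mult.commute[of "cdot v x"])
      then show ?thesis using S'(2)[of x] \<open>\<mu> \<ge> 0\<close> by (simp add: Smult inner_add_right)
    qed
    moreover have "S ** S = A"
    proof -
      have "(S ** S) *v x = A *v x" for x
      proof -
        have "(S ** S) *v x = S *v (S *v x)" by (simp add: matrix_vector_mul_assoc)
        also have "\<dots> = S' *v (S' *v x) + (of_real (sqrt \<mu>) * of_real (sqrt \<mu>) * cdot v x) *s v"
          by (simp add: Smult matrix_vector_right_distrib vec.scale S'v cdot_add_right cdot_smult_right
              vS' vv mult.assoc)
        also have "S' *v (S' *v x) = A' *v x" by (simp add: matrix_vector_mul_assoc S'(3))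
        also have "of_real (sqrt \<mu>) * of_real (sqrt \<mu>) = (of_real \<mu> :: complex)"
          using \<open>\<mu> \<ge> 0\<close> by (simp flip: of_real_mult)
        finally show ?thesis by (simp add: A'mult)
      qed
      then show ?thesis by (simp add: matrix_eq)
    qed
    moreover have "S *v x = 0" if "A *v x = 0" for x
      using that ker[OF that] S'(4)[of x] by (simp add: Smult A'mult)
    ultimately show ?thesis by blast
  qed
qed

lemma hpd_sqrt_exists:
  assumes "hermitian_posdef R"
  shows "\<exists>S. hermitian_posdef S \<and> S ** S = R"
proof -
  have R: "hermitian R" "\<And>x. x \<noteq> 0 \<Longrightarrow> 0 < x \<bullet> (R *v x)"
    using assms by (auto simp: hermitian_posdef_iff)
  have "0 \<le> x \<bullet> (R *v x)" for x using R(2)[of x] by (cases "x = 0") auto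
  then obtain S where S: "hermitian S" "\<And>x. 0 \<le> x \<bullet> (S *v x)" "S ** S = R"
    using psd_sqrt_exists[OF R(1)] by blast
  \<comment> \<open>The second root \<open>T\<close> writes the form of \<open>S\<close> at
    \<open>x\<close> as the squared norm of \<open>T *v x\<close>, so its vanishing gives
    \<open>S *v x = 0\<close> and then \<open>R *v x = 0\<close>.\<close>
  then obtain T where T: "hermitian T" "T ** T = S" using psd_sqrt_exists[OF S(1)] by blast
  have "0 < x \<bullet> (S *v x)" if "x \<noteq> 0" for x
  proof (rule ccontr)
    assume "\<not> ?thesis"
    then have "x \<bullet> (S *v x) = 0" using S(2)[of x] by simp
    then have "(T *v x) \<bullet> (T *v x) = 0"
      by (simp add: hermitian_inner[OF T(1), symmetric] matrix_vector_mul_assoc T(2))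
    then have "R *v x = 0"
      by (metis inner_eq_zero_iff matrix_vector_mul_assoc matrix_vector_mult_0_right S(3) T(2))
    then show False using R(2)[OF that] by simp
  qed
  then show ?thesis using S by (auto simp: hermitian_posdef_iff)
qed

text \<open>An eigenvector \<open>v\<close> of \<open>D = S - T\<close> with eigenvalue \<open>\<mu>\<close> satisfies
  \<open>\<mu> (v\<^sup>H S v + v\<^sup>H T v) = v\<^sup>H (S\<^sup>2 - T\<^sup>2) v = 0\<close>.\<close>
lemma hpd_sqrt_diff_nonpos:
  assumes "hermitian_posdef S" "hermitian_posdef T" "S ** S = T ** T"
  shows "x \<bullet> ((S - T) *v x) \<le> 0"
proof -
  have h: "hermitian S" "hermitian T" using assms by (auto simp: hermitian_posdef_iff)
  obtain v \<mu> where v: "norm v = 1" "(S - T) *v v = \<mu> *\<^sub>R v"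
      "\<And>x. x \<bullet> ((S - T) *v x) \<le> \<mu> * (norm x)\<^sup>2"
    using hermitian_top_eigenvector[OF hermitian_diff[OF h]] by blast
  have "v \<noteq> 0" using v(1) by auto
  then have pos: "v \<bullet> (S *v v) > 0" "v \<bullet> (T *v v) > 0"
    using assms by (auto simp: hermitian_posdef_iff)
  have eq: "S *v v - T *v v = \<mu> *\<^sub>R v"
    using v(2) by (simp add: matrix_vector_mult_diff_rdistrib)
  have "(S *v v) \<bullet> (S *v v) = (T *v v) \<bullet> (T *v v)"
    by (simp add: hermitian_inner[symmetric] h matrix_vector_mul_assoc assms(3))
  moreover have "(S *v v) \<bullet> (S *v v) - (T *v v) \<bullet> (T *v v) = (S *v v - T *v v) \<bullet> (S *v v + T *v v)"
    by (simp only: inner_diff_left inner_add_right inner_commute[of "T *v v" "S *v v"])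
  ultimately have "(\<mu> *\<^sub>R v) \<bullet> (S *v v + T *v v) = 0" unfolding eq by simp
  then have "\<mu> * (v \<bullet> (S *v v) + v \<bullet> (T *v v)) = 0"
    by (simp add: inner_add_right distrib_left)
  then have "\<mu> = 0" using pos by auto
  then show ?thesis using v(3)[of x] by simp
qed

text \<open>The sign bound holds for both orders of \<open>S\<close> and \<open>T\<close>, so the
  form of \<open>S - T\<close> vanishes identically.\<close>

lemma hpd_sqrt_unique:
  assumes "hermitian_posdef S" "hermitian_posdef T" "S ** S = T ** T"
  shows "S = T"
proof -
  have "S - T = 0"
  proof (rule hermitian_eq_zeroI)
    show "hermitian (S - T)" using assms by (auto simp: hermitian_posdef_iff intro: hermitian_diff)
    show "x \<bullet> ((S - T) *v x) = 0" for x
      using hpd_sqrt_diff_nonpos[OF assms, of x] hpd_sqrt_diff_nonpos[OF assms(2,1) assms(3)[symmetric], of x]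
      by (simp add: matrix_vector_mult_diff_rdistrib inner_diff_right)
  qed
  then show ?thesis by simp
qed

lemma hpd_sqrt_props:
  assumes "hermitian_posdef R"
  shows "hermitian (hpd_sqrt R)" "hpd_sqrt R ** hpd_sqrt R = R"
proof -
  have "\<exists>!S. hermitian_posdef S \<and> S ** S = R"
    using hpd_sqrt_exists[OF assms] hpd_sqrt_unique by metis
  from theI'[OF this, folded hpd_sqrt_def]
  show "hermitian (hpd_sqrt R)" "hpd_sqrt R ** hpd_sqrt R = R"
    by (auto simp: hermitian_posdef_iff)
qed

subsection \<open>Laplace representation of the rate\<close>

lemma borel_measurable_cdot [measurable (raw)]:
  "f \<in> borel_measurable M \<Longrightarrow> (\<lambda>x. cdot a (f x)) \<in> borel_measurable M"
  unfolding cdot_def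
  by (rule measurable_compose[of f M borel]) (auto intro!: borel_measurable_continuous_onI continuous_intros)

lemma borel_measurable_cnj [measurable (raw)]:
  "f \<in> borel_measurable M \<Longrightarrow> (\<lambda>x. cnj (f x)) \<in> borel_measurable M"
  by (rule measurable_compose[of f M borel]) (auto intro!: borel_measurable_continuous_onI continuous_intros)

lemma borel_measurable_matrix_vector_mult [measurable (raw)]:
  "f \<in> borel_measurable M \<Longrightarrow> (\<lambda>x. (A::complex^'n^'n) *v f x) \<in> borel_measurable M"
  by (rule measurable_compose[of f M borel])
    (auto intro!: borel_measurable_continuous_onI continuous_matrix_vector_mult continuous_on_id)

definition relay_rate :: "real \<Rightarrow> real \<Rightarrow> real" where
  "relay_rate p q = ln (1 + p) + ln (1 + q) - ln (1 + p + q)"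

text \<open>The integrand of a Frullani-type representation of \<open>relay_rate\<close>. At
  \<open>s = 0\<close> division by zero makes it \<open>0\<close>.\<close>

definition rate_kernel :: "real \<Rightarrow> real \<Rightarrow> real \<Rightarrow> real" where
  "rate_kernel p q s = exp (- s) / s * ((1 - exp (- (s * p))) * (1 - exp (- (s * q))))"

lemma nn_integral_exp_diff:
  fixes \<alpha> p :: real
  assumes "0 < \<alpha>" "0 \<le> p"
  shows "(\<integral>\<^sup>+s. ennreal (exp (- (s * \<alpha>)) * (1 - exp (- (s * p)))) * indicator {0..} s \<partial>lborel)
    = ennreal (1 / \<alpha> - 1 / (\<alpha> + p))"
proof -
  let ?F = "\<lambda>s. exp (- (s * (\<alpha> + p))) / (\<alpha> + p) - exp (- (s * \<alpha>)) / \<alpha>"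
  have "(\<integral>\<^sup>+s. ennreal (exp (- (s * \<alpha>)) * (1 - exp (- (s * p)))) * indicator {0..} s \<partial>lborel)
    = ennreal (0 - ?F 0)"
  proof (rule nn_integral_FTC_atLeast)
    show "(?F \<longlongrightarrow> 0) at_top"
    proof -
      have "((\<lambda>s. exp (- (s * c)) / c) \<longlongrightarrow> 0) at_top" if "c > 0" for c :: real
        using that by real_asymp
      from tendsto_diff[OF this this, of "\<alpha> + p" \<alpha>] assms show ?thesis by simp
    qed
    show "DERIV ?F s :> exp (- (s * \<alpha>)) * (1 - exp (- (s * p)))" for s
    proof -
      have "DERIV (\<lambda>s. exp (- (s * c)) / c) s :> - exp (- (s * c))" if "c > 0" for c :: real
        using that by (auto intro!: derivative_eq_intros)
      from DERIV_diff[OF this this, of "\<alpha> + p" \<alpha>] assms show ?thesis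
        by (simp add: right_diff_distrib distrib_left exp_add[symmetric])
    qed
  qed (use assms in auto)
  then show ?thesis by simp
qed

text \<open>The factor \<open>(1 - exp (- (s * q))) / s\<close> is the integral of
  \<open>exp (- (s * x))\<close> over \<open>0 \<le> x \<le> q\<close>. Tonelli then leaves
  \<open>1 / (1 + x) - 1 / (1 + x + p)\<close>, whose antiderivative is logarithmic.\<close>

lemma nn_integral_rate_kernel:
  assumes "0 \<le> p" "0 \<le> q"
  shows "(\<integral>\<^sup>+s. ennreal (rate_kernel p q s) * indicator {0..} s \<partial>lborel) = ennreal (relay_rate p q)"
proof -
  let ?g = "\<lambda>s x. exp (- (s * (1 + x))) * (1 - exp (- (s * p)))"
  have inner: "(\<integral>\<^sup>+x. ennreal (?g s x) * indicator {0..q} x \<partial>lborel) = ennreal (rate_kernel p q s)" if "s \<ge> 0" for s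
  proof (cases "s = 0")
    case False
    then have "s > 0" using that by simp
    let ?F = "\<lambda>x. - exp (- (s * (1 + x))) / s * (1 - exp (- (s * p)))"
    have "(\<integral>\<^sup>+x. ennreal (?g s x) * indicator {0..q} x \<partial>lborel) = ennreal (?F q - ?F 0)"
      using \<open>s > 0\<close> assms
      by (intro nn_integral_FTC_Icc) (auto intro!: derivative_eq_intros simp: field_simps)
    also have "?F q - ?F 0 = rate_kernel p q s"
      using \<open>s > 0\<close> unfolding rate_kernel_def by (simp add: field_simps exp_add[symmetric] exp_diff exp_minus)
    finally show ?thesis .
  qed (simp add: rate_kernel_def)
  have "(\<integral>\<^sup>+s. ennreal (rate_kernel p q s) * indicator {0..} s \<partial>lborel)
     = (\<integral>\<^sup>+s. (\<integral>\<^sup>+x. ennreal (?g s x) * indicator {0..q} x * indicator {0..} s \<partial>lborel) \<partial>lborel)"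
    by (intro nn_integral_cong) (auto simp: inner nn_integral_multc split: split_indicator)
  also have "\<dots> = (\<integral>\<^sup>+x. (\<integral>\<^sup>+s. ennreal (?g s x) * indicator {0..q} x * indicator {0..} s \<partial>lborel) \<partial>lborel)"
    by (rule lborel_pair.Fubini') measurable
  also have "\<dots> = (\<integral>\<^sup>+x. ennreal (1 / (1 + x) - 1 / (1 + x + p)) * indicator {0..q} x \<partial>lborel)"
    using assms nn_integral_exp_diff[OF _ assms(1)]
    by (intro nn_integral_cong) (auto split: split_indicator)
  also have "\<dots> = ennreal ((ln (1 + q) - ln (1 + q + p)) - (ln (1 + 0) - ln (1 + 0 + p)))"
    using assms
    by (intro nn_integral_FTC_Icc) (auto intro!: derivative_eq_intros simp: field_simps)
  also have "(ln (1 + q) - ln (1 + q + p)) - (ln (1 + 0) - ln (1 + 0 + p)) = relay_rate p q"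
    by (simp add: relay_rate_def add_ac)
  finally show ?thesis .
qed

subsection \<open>Gaussian integrals\<close>

lemma nn_integral_lborel_shift:
  fixes c :: "'a::euclidean_space"
  assumes [measurable]: "f \<in> borel_measurable borel"
  shows "(\<integral>\<^sup>+x. f (x - c) \<partial>lborel) = (\<integral>\<^sup>+x. f x \<partial>lborel)"
proof -
  have "(\<integral>\<^sup>+x. f x \<partial>lborel) = (\<integral>\<^sup>+x. f x \<partial>distr lborel borel ((+) (- c)))"
    by (simp add: lborel_distr_plus)
  also have "\<dots> = (\<integral>\<^sup>+x. f (x - c) \<partial>lborel)"
    by (simp add: nn_integral_distr)
  finally show ?thesis by simp
qed

lemma nn_integral_lborel_scale:
  fixes f :: "'a::euclidean_space \<Rightarrow> ennreal"
  assumes [measurable]: "f \<in> borel_measurable borel" and "0 < c"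
  shows "(\<integral>\<^sup>+x. f x \<partial>lborel) = ennreal (c ^ DIM('a)) * (\<integral>\<^sup>+x. f (c *\<^sub>R x) \<partial>lborel)"
  using assms(2) by (subst lborel_affine[of c 0])
     (simp_all add: nn_integral_density nn_integral_distr nn_integral_cmult)

text \<open>The integrand factors over the basis into one-dimensional Gaussians. The value is not
  computed, since Gaussian constants are later cancelled or carried along.\<close>

lemma nn_integral_gauss_finite:
  "(\<integral>\<^sup>+x. ennreal (exp (- (norm x)\<^sup>2)) \<partial>(lborel::'a::euclidean_space measure)) < \<infinity>"
proof -
  have real: "(\<integral>\<^sup>+x. ennreal (exp (- x\<^sup>2)) \<partial>lborel) < \<infinity>"
  proof -
    have "has_bochner_integral lborel (\<lambda>x::real. exp (- x\<^sup>2)) (2 *\<^sub>R (sqrt pi / 2))"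
      by (rule has_bochner_integral_even_function[OF gaussian_moment_0]) simp
    then show ?thesis by (auto simp: has_bochner_integral_iff integrable_iff_bounded)
  qed
  have "(\<integral>\<^sup>+x. ennreal (exp (- (norm x)\<^sup>2)) \<partial>(lborel::'a measure))
     = (\<integral>\<^sup>+x. (\<Prod>b\<in>Basis. ennreal (exp (- (x \<bullet> b)\<^sup>2))) \<partial>(lborel::'a measure))"
    by (intro nn_integral_cong)
      (simp add: prod_ennreal exp_sum[symmetric] sum_negf norm_eq_sqrt_inner euclidean_inner[of x x for x]
        sum_nonneg power2_eq_square)
  also have "\<dots> = (\<Prod>b\<in>(Basis::'a set). (\<integral>\<^sup>+x. ennreal (exp (- x\<^sup>2)) \<partial>lborel))"
    by (rule nn_integral_lborel_prod) auto
  also have "\<dots> < \<infinity>" using real by (simp add: power_less_top_ennreal)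
  finally show ?thesis .
qed

lemma nn_integral_gauss_pos:
  "0 < (\<integral>\<^sup>+x. ennreal (exp (- (norm x)\<^sup>2)) \<partial>(lborel::'a::euclidean_space measure))"
proof -
  have "\<not> (AE x in (lborel::'a measure). False)" by (simp add: AE_iff_measurable[OF _ refl])
  then show ?thesis
    by (subst zero_less_iff_neq_zero, subst nn_integral_0_iff_AE) auto
qed

text \<open>Writing \<open>e\<^bsup>|y|\<^sup>2\<^esup>\<close> as a Gaussian average of \<open>e\<^bsup>2 Re (cnj g y)\<^esup>\<close> reduces the rank-one
  update to completing a square, so that only translation invariance of Lebesgue measure is used and
  no determinant is needed.\<close>
lemma nn_integral_gauss_rank_one:
  fixes q :: "complex^'n \<Rightarrow> real" and a b :: "complex^'n"
  assumes [measurable]: "q \<in> borel_measurable borel"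
    and q: "\<And>z g. q (z - g *s b) = q z - 2 * Re (cnj g * cdot a z) + (cmod g)\<^sup>2 * m"
    and ab: "cdot a b = of_real m" and m: "0 \<le> m"
  shows "ennreal (1 + m) * (\<integral>\<^sup>+z. ennreal (exp (- (q z + (cmod (cdot a z))\<^sup>2))) \<partial>lborel)
    = (\<integral>\<^sup>+z. ennreal (exp (- q z)) \<partial>lborel)" (is "_ * ?I' = ?I")
proof -
  define K where "K = (\<integral>\<^sup>+g. ennreal (exp (- (norm (g::complex))\<^sup>2)) \<partial>lborel)"
  have K: "K \<noteq> 0" "K \<noteq> \<top>"
    using nn_integral_gauss_finite[where 'a=complex] nn_integral_gauss_pos[where 'a=complex] by (auto simp: K_def)
  let ?y = "cdot a" and ?q' = "\<lambda>z. q z + (cmod (cdot a z))\<^sup>2"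
  \<comment> \<open>If \<open>q\<close> is thought of as the form of a matrix \<open>M\<close> with
    \<open>M b = a\<close>, then \<open>?q'\<close> belongs to \<open>M + a a^H\<close>, which sends
    \<open>b\<close> to \<open>(1 + m) a\<close>. Hence \<open>b'\<close> is the shift for the
    enlarged form, as in the Sherman-Morrison formula.\<close>
  define b' where "b' = (1 / of_real (1 + m)) *s b"
  have sq: "(cmod (u - v))\<^sup>2 = (cmod u)\<^sup>2 - 2 * Re (cnj v * u) + (cmod v)\<^sup>2" for u v :: complex
    unfolding cmod_power2 by (simp add: power2_eq_square algebra_simps)
  have sqk: "(cmod (u - of_real k * v))\<^sup>2 = (cmod u)\<^sup>2 - 2 * k * Re (cnj v * u) + k\<^sup>2 * (cmod v)\<^sup>2"
    for u v :: complex and k :: real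
    unfolding cmod_power2 by (simp add: power2_eq_square algebra_simps)
  have q': "?q' (z - g *s b') = ?q' z - 2 * Re (cnj g * ?y z) + (cmod g)\<^sup>2 * (m / (1 + m))" for z g
  proof -
    have m1: "1 + m > 0" using m by simp
    have "g *s b' = (g / of_real (1 + m)) *s b" by (simp add: b'_def)
    then have "q (z - g *s b') = q z - 2 * Re (cnj g * ?y z) / (1 + m) + (cmod g)\<^sup>2 * m / (1 + m)\<^sup>2"
      using q[of z "g / of_real (1 + m)"] m1
      by (simp add: norm_divide power_divide abs_of_pos del: of_real_add)
    moreover have "?y (z - g *s b') = ?y z - of_real (m / (1 + m)) * g"
      by (simp add: b'_def cdot_diff_right cdot_smult_right ab)
    then have "(cmod (?y (z - g *s b')))\<^sup>2 = (cmod (?y z))\<^sup>2 - 2 * (m / (1 + m)) * Re (cnj g * ?y z)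
        + (m / (1 + m))\<^sup>2 * (cmod g)\<^sup>2"
      by (simp only: sqk)
    ultimately have "?q' (z - g *s b') = ?q' z - 2 * Re (cnj g * ?y z) * (1 / (1 + m) + m / (1 + m))
       + (cmod g)\<^sup>2 * (m / (1 + m)\<^sup>2 + (m / (1 + m))\<^sup>2)"
      by (simp add: algebra_simps add_divide_distrib)
    also have "1 / (1 + m) + m / (1 + m) = 1"
      using m1 by (simp add: add_divide_distrib[symmetric])
    also have "m / (1 + m)\<^sup>2 + (m / (1 + m))\<^sup>2 = m / (1 + m)"
    proof -
      have "m / (1 + m)\<^sup>2 + (m / (1 + m))\<^sup>2 = m * (1 + m) / ((1 + m) * (1 + m))"
        by (simp add: power2_eq_square add_divide_distrib[symmetric] distrib_left)
      then show ?thesis using m1 by simp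
    qed
    finally show ?thesis by simp
  qed
  \<comment> \<open>An auxiliary complex Gaussian \<open>g\<close> is recentred at
    \<open>?y z\<close>: expanding the square turns \<open>q\<close> into \<open>?q'\<close> plus a
    coupling linear in \<open>g\<close>.\<close>
  have "K * ?I = (\<integral>\<^sup>+z. ennreal (exp (- q z)) * K \<partial>lborel)"
    by (subst nn_integral_multc) (simp_all add: mult.commute)
  also have "\<dots> = (\<integral>\<^sup>+z. (\<integral>\<^sup>+g. ennreal (exp (- (cmod g)\<^sup>2)) * ennreal (exp (- (?q' z - 2 * Re (cnj g * ?y z)))) \<partial>lborel) \<partial>lborel)"
  proof (intro nn_integral_cong)
    fix z
    have "ennreal (exp (- q z)) * K = ennreal (exp (- q z)) * (\<integral>\<^sup>+g. ennreal (exp (- (norm (g - ?y z))\<^sup>2)) \<partial>lborel)"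
      unfolding K_def by (subst nn_integral_lborel_shift[of "\<lambda>g. ennreal (exp (- (norm g)\<^sup>2))"]) auto
    also have "\<dots> = (\<integral>\<^sup>+g. ennreal (exp (- q z)) * ennreal (exp (- (norm (g - ?y z))\<^sup>2)) \<partial>lborel)"
      by (rule nn_integral_cmult[symmetric]) simp
    also have "\<dots> = (\<integral>\<^sup>+g. ennreal (exp (- (cmod g)\<^sup>2)) * ennreal (exp (- (?q' z - 2 * Re (cnj g * ?y z)))) \<partial>lborel)"
      by (intro nn_integral_cong)
        (simp add: sq ennreal_mult[symmetric] exp_add[symmetric] algebra_simps)
    finally show "ennreal (exp (- q z)) * K = \<dots>" .
  qed
  also have "\<dots> = (\<integral>\<^sup>+g. (\<integral>\<^sup>+z. ennreal (exp (- (cmod g)\<^sup>2)) * ennreal (exp (- (?q' z - 2 * Re (cnj g * ?y z)))) \<partial>lborel) \<partial>lborel)"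
    by (rule lborel_pair.Fubini') measurable
  \<comment> \<open>For fixed \<open>g\<close> the coupling is removed by the shift
    \<open>g *s b'\<close>. The exponent left in \<open>g\<close> is
    \<open>- (cmod g)\<^sup>2 + (cmod g)\<^sup>2 * (m / (1 + m))\<close>.\<close>
  also have "\<dots> = (\<integral>\<^sup>+g. ennreal (exp (- (cmod g)\<^sup>2 / (1 + m))) * ?I' \<partial>lborel)"
  proof (intro nn_integral_cong)
    fix g :: complex
    have "?I' = (\<integral>\<^sup>+z. ennreal (exp (- ?q' (z - g *s b'))) \<partial>lborel)"
      by (subst nn_integral_lborel_shift[of "\<lambda>z. ennreal (exp (- ?q' z))"]) auto
    then have "ennreal (exp (- (cmod g)\<^sup>2 / (1 + m))) * ?I'
       = (\<integral>\<^sup>+z. ennreal (exp (- (cmod g)\<^sup>2 / (1 + m))) * ennreal (exp (- (?q' z - 2 * Re (cnj g * ?y z) + (cmod g)\<^sup>2 * (m / (1 + m))))) \<partial>lborel)"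
      unfolding q' by (simp add: nn_integral_cmult)
    also have "\<dots> = (\<integral>\<^sup>+z. ennreal (exp (- (cmod g)\<^sup>2)) * ennreal (exp (- (?q' z - 2 * Re (cnj g * ?y z)))) \<partial>lborel)"
    proof (intro nn_integral_cong)
      fix z
      have "- (cmod g)\<^sup>2 / (1 + m) - (cmod g)\<^sup>2 * (m / (1 + m)) = - (cmod g)\<^sup>2"
      proof -
        have "- (cmod g)\<^sup>2 / (1 + m) - (cmod g)\<^sup>2 * (m / (1 + m)) = - ((cmod g)\<^sup>2 * ((1 + m) / (1 + m)))"
          by (simp only: add_divide_distrib distrib_left) simp
        then show ?thesis using m by simp
      qed
      then show "ennreal (exp (- (cmod g)\<^sup>2 / (1 + m))) * ennreal (exp (- (?q' z - 2 * Re (cnj g * ?y z) + (cmod g)\<^sup>2 * (m / (1 + m)))))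
        = ennreal (exp (- (cmod g)\<^sup>2)) * ennreal (exp (- (?q' z - 2 * Re (cnj g * ?y z))))"
        by (simp add: ennreal_mult[symmetric] exp_add[symmetric] algebra_simps)
    qed
    finally show "(\<integral>\<^sup>+z. ennreal (exp (- (cmod g)\<^sup>2)) * ennreal (exp (- (?q' z - 2 * Re (cnj g * ?y z)))) \<partial>lborel)
       = ennreal (exp (- (cmod g)\<^sup>2 / (1 + m))) * ?I'" by simp
  qed
  also have "\<dots> = (\<integral>\<^sup>+g. ennreal (exp (- (cmod g)\<^sup>2 / (1 + m))) \<partial>lborel) * ?I'"
    by (rule nn_integral_multc) simp
  \<comment> \<open>Scaling by \<open>sqrt (1 + m)\<close> in \<open>complex\<close>, of real
    dimension 2, produces the factor \<open>1 + m\<close>.\<close>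
  also have "(\<integral>\<^sup>+g. ennreal (exp (- (cmod g)\<^sup>2 / (1 + m))) \<partial>lborel) = ennreal (1 + m) * K"
    using m unfolding K_def
    by (subst nn_integral_lborel_scale[of _ "sqrt (1 + m)"]) (auto simp: power_mult_distrib)
  finally have "K * ?I = K * (ennreal (1 + m) * ?I')" by (simp add: mult_ac)
  then show ?thesis using K by (auto simp: ennreal_mult_cancel_left)
qed

section \<open>The measure \<open>cgauss\<close> and its Laplace transforms\<close>

lemma sets_cgauss [measurable_cong, simp]: "sets cgauss = sets borel"
  by (simp add: cgauss_def)

lemma space_cgauss [simp]: "space cgauss = UNIV"
  by (simp add: cgauss_def)

lemma nn_integral_cgauss:
  fixes f :: "complex^'n \<Rightarrow> ennreal"
  assumes [measurable]: "f \<in> borel_measurable borel"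
  shows "(\<integral>\<^sup>+z. f z \<partial>cgauss)
    = ennreal (1 / pi ^ CARD('n)) * (\<integral>\<^sup>+z. ennreal (exp (- (norm z)\<^sup>2)) * f z \<partial>lborel)"
proof -
  have "(\<integral>\<^sup>+z. f z \<partial>cgauss) = (\<integral>\<^sup>+z. ennreal (exp (- (norm z)\<^sup>2) / pi ^ CARD('n)) * f z \<partial>lborel)"
    unfolding cgauss_def by (rule nn_integral_density) auto
  also have "\<dots> = (\<integral>\<^sup>+z. ennreal (1 / pi ^ CARD('n)) * (ennreal (exp (- (norm z)\<^sup>2)) * f z) \<partial>lborel)"
    by (intro nn_integral_cong) (simp add: ennreal_mult[symmetric] mult.assoc[symmetric])
  finally show ?thesis by (simp add: nn_integral_cmult)
qed

lemma finite_measure_cgauss: "finite_measure (cgauss :: (complex^'n) measure)"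
proof
  have "emeasure cgauss (space (cgauss :: (complex^'n) measure)) = (\<integral>\<^sup>+z. 1 \<partial>(cgauss :: (complex^'n) measure))"
    by simp
  also have "\<dots> \<noteq> \<infinity>"
    by (subst nn_integral_cgauss)
      (use nn_integral_gauss_finite[where 'a="complex^'n"] in \<open>auto simp: ennreal_mult_eq_top_iff\<close>)
  finally show "emeasure cgauss (space (cgauss :: (complex^'n) measure)) \<noteq> \<infinity>" .
qed

interpretation cgauss: finite_measure cgauss
  by (rule finite_measure_cgauss)

lemma integrable_cgauss_bounded:
  fixes f :: "complex^'n \<Rightarrow> real"
  assumes "f \<in> borel_measurable borel" "\<And>z. \<bar>f z\<bar> \<le> K"
  shows "integrable cgauss f"
  using assms by (intro cgauss.integrable_const_bound[of _ K]) (auto simp: measurable_cong_sets[OF sets_cgauss refl])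

text \<open>The density contributes \<open>(norm z)\<^sup>2\<close>, so
  \<open>nn_integral_gauss_rank_one\<close> applies with
  \<open>q z = (norm z)\<^sup>2 + P z\<close>.\<close>

lemma cgauss_rank_one:
  fixes P :: "complex^'n \<Rightarrow> real" and a b :: "complex^'n"
  assumes [measurable]: "P \<in> borel_measurable borel"
    and P: "\<And>z g. (norm (z - g *s b))\<^sup>2 + P (z - g *s b)
      = (norm z)\<^sup>2 + P z - 2 * Re (cnj g * cdot a z) + (cmod g)\<^sup>2 * m"
    and ab: "cdot a b = of_real m" and m: "0 \<le> m"
  shows "(1 + m) * (\<integral>z. exp (- (P z + (cmod (cdot a z))\<^sup>2)) \<partial>cgauss) = (\<integral>z. exp (- P z) \<partial>cgauss)"
proof -
  have *: "(\<integral>\<^sup>+z. ennreal (exp (- f z)) \<partial>cgauss)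
     = ennreal (1 / pi ^ CARD('n)) * (\<integral>\<^sup>+z. ennreal (exp (- ((norm z)\<^sup>2 + f z))) \<partial>lborel)"
    if [measurable]: "f \<in> borel_measurable borel" for f :: "complex^'n \<Rightarrow> real"
    by (subst nn_integral_cgauss) (simp_all add: ennreal_mult[symmetric] exp_add[symmetric] algebra_simps)
  have "ennreal (1 + m) * (\<integral>\<^sup>+z. ennreal (exp (- (P z + (cmod (cdot a z))\<^sup>2))) \<partial>cgauss)
     = (\<integral>\<^sup>+z. ennreal (exp (- P z)) \<partial>cgauss)"
  proof -
    have "ennreal (1 + m) * (\<integral>\<^sup>+z. ennreal (exp (- ((norm z)\<^sup>2 + P z + (cmod (cdot a z))\<^sup>2))) \<partial>lborel)
       = (\<integral>\<^sup>+z. ennreal (exp (- ((norm z)\<^sup>2 + P z))) \<partial>lborel)"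
      by (rule nn_integral_gauss_rank_one[OF _ P ab m]) measurable
    moreover have "(\<lambda>z. P z + (cmod (cdot a z))\<^sup>2) \<in> borel_measurable borel" by measurable
    ultimately show ?thesis
      by (simp only: *[OF assms(1)] * mult.left_commute[of "ennreal (1 + m)"] add.assoc)
  qed
  from arg_cong[OF this, of enn2real] m show ?thesis
    by (simp add: integral_eq_nn_integral enn2real_mult del: ennreal_plus)
qed

lemma power2_norm_diff: "(norm (x - y :: complex^'n))\<^sup>2 = (norm x)\<^sup>2 - 2 * Re (cdot y x) + (norm y)\<^sup>2"
  by (simp add: power2_norm_eq_inner inner_eq_Re_cdot[symmetric] inner_diff_left inner_diff_right inner_commute)

text \<open>Since \<open>b\<close> solves \<open>(1 + s S^2) b = a\<close>, a shift along
  \<open>b\<close> completes the square in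
  \<open>(norm z)\<^sup>2 + s * (norm (S *v z))\<^sup>2\<close>. The number
  \<open>a \<bullet> b\<close> is the resolvent value \<open>a^H (1 + s S^2)^-1 a\<close>, which for
  \<open>a = S *v w\<close> is the \<open>m\<close> of the overview.\<close>

lemma cgauss_laplace:
  fixes S :: "complex^'n^'n" and a b :: "complex^'n"
  assumes S: "hermitian S" and "0 \<le> s" "0 \<le> t" and b: "b + s *\<^sub>R (S *v (S *v b)) = a"
  shows "(1 + t * (a \<bullet> b)) * (\<integral>z. exp (- (s * (norm (S *v z))\<^sup>2 + t * (cmod (cdot a z))\<^sup>2)) \<partial>cgauss)
    = (\<integral>z. exp (- (s * (norm (S *v z))\<^sup>2)) \<partial>cgauss)"
proof -
  \<comment> \<open>Scaling by \<open>sqrt t\<close> absorbs the factor \<open>t\<close> into the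
    rank-one term.\<close>
  let ?a = "sqrt t *\<^sub>R a" and ?b = "sqrt t *\<^sub>R b"
  let ?P = "\<lambda>z. s * (norm (S *v z))\<^sup>2"
  have ca: "cdot a z = cdot b z + of_real s * cdot (S *v b) (S *v z)" for z
  proof -
    have "cdot a z = cdot b z + cdot (s *\<^sub>R (S *v (S *v b))) z"
      unfolding b[symmetric] by (simp add: cdot_def algebra_simps sum.distrib)
    then show ?thesis by (simp add: cdot_scaleR_left hermitian_cdot[OF S])
  qed
  have abm: "cdot a b = of_real ((norm b)\<^sup>2 + s * (norm (S *v b))\<^sup>2)"
    by (simp add: ca cdot_self)
  then have abr: "a \<bullet> b = (norm b)\<^sup>2 + s * (norm (S *v b))\<^sup>2"
    by (simp add: inner_eq_Re_cdot)
  have "(1 + t * (a \<bullet> b)) * (\<integral>z. exp (- (?P z + (cmod (cdot ?a z))\<^sup>2)) \<partial>cgauss)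
    = (\<integral>z. exp (- ?P z) \<partial>cgauss)"
  proof (rule cgauss_rank_one)
    show "?P \<in> borel_measurable borel" by measurable
    show "cdot ?a ?b = of_real (t * (a \<bullet> b))"
      using \<open>0 \<le> t\<close> abm abr
      by (simp add: scaleR_eq_smult cdot_smult_left cdot_smult_right mult.assoc[symmetric] del: of_real_add)
        (simp flip: of_real_mult of_real_power)
    show "0 \<le> t * (a \<bullet> b)" using assms by (simp add: abr)
    fix z :: "complex^'n" and g
    have bb: "g *s ?b = (g * of_real (sqrt t)) *s b" by (simp add: scaleR_eq_smult vector_smult_assoc)
    let ?g = "g * of_real (sqrt t)"
    have "(norm (z - g *s ?b))\<^sup>2 + ?P (z - g *s ?b)
      = (norm z)\<^sup>2 + ?P z - 2 * Re (cnj ?g * cdot a z) + (cmod ?g)\<^sup>2 * (a \<bullet> b)"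
      unfolding bb abr
      by (simp add: matrix_vector_mult_diff_distrib vec.scale power2_norm_diff norm_smult cdot_smult_left
          ca power_mult_distrib del: complex_cnj_mult complex_cnj_complex_of_real) (simp add: algebra_simps)
    also have "Re (cnj ?g * cdot a z) = Re (cnj g * cdot ?a z)"
      by (simp add: cdot_scaleR_left)
    also have "(cmod ?g)\<^sup>2 = (cmod g)\<^sup>2 * t"
      using \<open>0 \<le> t\<close> by (simp add: norm_mult power_mult_distrib)
    finally show "(norm (z - g *s ?b))\<^sup>2 + ?P (z - g *s ?b)
      = (norm z)\<^sup>2 + ?P z - 2 * Re (cnj g * cdot ?a z) + (cmod g)\<^sup>2 * (t * (a \<bullet> b))"
      by simp
  qed
  moreover have "(cmod (cdot ?a z))\<^sup>2 = t * (cmod (cdot a z))\<^sup>2" for z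
    using \<open>0 \<le> t\<close> by (simp add: cdot_scaleR_left norm_mult power_mult_distrib)
  ultimately show ?thesis by simp
qed

text \<open>The case \<open>S = 0\<close>, where \<open>b = a\<close>.\<close>

lemma cgauss_laplace_linear:
  fixes a :: "complex^'n"
  assumes "0 \<le> t"
  shows "(\<integral>z. exp (- (t * (cmod (cdot a z))\<^sup>2)) \<partial>cgauss) = measure (cgauss :: (complex^'n) measure) UNIV / (1 + t * (norm a)\<^sup>2)"
proof -
  have "0 < 1 + t * (norm a)\<^sup>2" using assms by (simp add: add_pos_nonneg)
  then show ?thesis
    using cgauss_laplace[OF hermitian_zero, of 0 t a a] assms
    by (simp add: power2_norm_eq_inner field_simps)
qed

section \<open>Resolvent bounds and the comparison of receive vectors\<close>

text \<open>Pairing the image of \<open>x\<close> with \<open>x\<close> gives at least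
  \<open>x \<bullet> x\<close>, so the map is injective, hence onto in finite dimension.\<close>

lemma resolvent_exists:
  fixes S :: "complex^'n^'n"
  assumes S: "hermitian S" and "0 \<le> s"
  obtains b where "b + s *\<^sub>R (S *v (S *v b)) = a"
proof -
  let ?f = "\<lambda>b. b + s *\<^sub>R (S *v (S *v b))"
  have lin: "linear ?f"
    by (rule linearI) (simp_all add: matrix_vector_right_distrib cmatrix_vector_mult_scaleR algebra_simps)
  have "x = 0" if "?f x = 0" for x
  proof -
    have "0 = x \<bullet> ?f x" using that by simp
    also have "\<dots> = x \<bullet> x + s * ((S *v x) \<bullet> (S *v x))"
      by (simp add: inner_add_right hermitian_inner[OF S])
    finally have "x \<bullet> x \<le> 0" using \<open>0 \<le> s\<close> by (smt (verit) inner_ge_zero mult_nonneg_nonneg)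
    then show ?thesis by (metis inner_eq_zero_iff inner_ge_zero order_antisym)
  qed
  then have "inj ?f" using linear_injective_0[OF lin] by blast
  then have "surj ?f" by (rule linear_inj_imp_surj[OF lin])
  then obtain b where "a = ?f b" by (rule surjE)
  then show ?thesis using that[of b] by simp
qed

text \<open>With \<open>R = S ** S\<close> and \<open>a = (1 + s R) b\<close>, this is
  \<open>(1 + s R)^2 \<le> (1 + s L) (1 + s R)\<close> as forms at \<open>b\<close>, checked term by
  term from \<open>R \<le> L\<close>.\<close>

lemma resolvent_lower_bound:
  fixes S :: "complex^'n^'n"
  assumes S: "hermitian S" and "0 \<le> s" and L: "\<And>x. x \<bullet> ((S ** S) *v x) \<le> L * (norm x)\<^sup>2"
    and b: "b + s *\<^sub>R (S *v (S *v b)) = a"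
  shows "(norm a)\<^sup>2 \<le> (1 + s * L) * (a \<bullet> b)"
proof -
  have L': "(norm (S *v x))\<^sup>2 \<le> L * (norm x)\<^sup>2" for x
    using L[of x] by (simp add: power2_norm_eq_inner matrix_vector_mul_assoc[symmetric] hermitian_inner[OF S])
  have SS: "b \<bullet> (S *v (S *v b)) = (norm (S *v b))\<^sup>2"
    by (simp add: power2_norm_eq_inner hermitian_inner[OF S])
  have aa: "(norm a)\<^sup>2 = (norm b)\<^sup>2 + 2 * s * (norm (S *v b))\<^sup>2 + s\<^sup>2 * (norm (S *v (S *v b)))\<^sup>2"
  proof -
    have "(norm a)\<^sup>2 = b \<bullet> b + 2 * s * (b \<bullet> (S *v (S *v b))) + s\<^sup>2 * ((S *v (S *v b)) \<bullet> (S *v (S *v b)))"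
      unfolding b[symmetric] power2_norm_eq_inner
      by (simp add: inner_add_left inner_add_right inner_commute[of "S *v (S *v b)" b] power2_eq_square[of s] algebra_simps)
    then show ?thesis by (simp only: SS power2_norm_eq_inner[symmetric])
  qed
  have ab: "a \<bullet> b = (norm b)\<^sup>2 + s * (norm (S *v b))\<^sup>2"
    unfolding b[symmetric]
    by (simp add: inner_add_left inner_commute[of "S *v (S *v b)" b] SS power2_norm_eq_inner[of b])
  have "s * (norm (S *v b))\<^sup>2 \<le> s * (L * (norm b)\<^sup>2)"
    using L' \<open>0 \<le> s\<close> by (rule mult_left_mono)
  moreover have "s\<^sup>2 * (norm (S *v (S *v b)))\<^sup>2 \<le> s\<^sup>2 * (L * (norm (S *v b))\<^sup>2)"
    using L' by (rule mult_left_mono) simp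
  ultimately show ?thesis unfolding aa ab by (simp add: algebra_simps power2_eq_square)
qed

text \<open>The scalar core of the receive comparison: \<open>M\<close> stands for
  \<open>w^H R w\<close>, \<open>m\<close> for its resolvent counterpart, \<open>C\<close> for the
  total mass and \<open>D\<close> for the transform of the squared norm.\<close>

lemma laplace_comparison:
  fixes C D L M m s t :: real
  assumes "0 \<le> s" "0 \<le> t" "0 \<le> M" "M \<le> L" "0 \<le> D" "0 \<le> m"
    and D: "(1 + s * L) * D \<le> C" and m: "M \<le> (1 + s * L) * m"
  shows "D / (1 + t * m) - D * (1 + s * L) / (1 + s * L + t * L) \<le> C / (1 + t * M) - C / (1 + t * L)"
proof -
  have L: "0 \<le> s * L" "0 \<le> t * L" "0 \<le> t * M" "0 \<le> t * m" "t * M \<le> t * L"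
    using assms by (auto intro: mult_left_mono)
  have C: "0 \<le> C" using D L assms(5) by (smt (verit) mult_nonneg_nonneg)
  have "1 + s * L + t * M \<le> (1 + s * L) * (1 + t * m)"
    using mult_left_mono[OF m assms(2)] by (simp add: algebra_simps)
  \<comment> \<open>The lower bound on \<open>m\<close> replaces it by
    \<open>M / (1 + s * L)\<close>.\<close>
  then have "D / (1 + t * m) \<le> D * (1 + s * L) / (1 + s * L + t * M)"
    using L assms(5) by (simp add: divide_simps mult.assoc mult_left_mono)
  then have "D / (1 + t * m) - D * (1 + s * L) / (1 + s * L + t * L)
     \<le> (D * (1 + s * L)) * (1 / (1 + s * L + t * M) - 1 / (1 + s * L + t * L))"
    by (simp add: algebra_simps)
  \<comment> \<open>The bracket is non-negative since \<open>M \<le> L\<close>, so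
    \<open>(1 + s * L) * D \<le> C\<close> may be multiplied in.\<close>
  also have "\<dots> \<le> C * (1 / (1 + s * L + t * M) - 1 / (1 + s * L + t * L))"
    using D L by (intro mult_right_mono) (auto simp: mult.commute intro!: divide_left_mono mult_pos_pos)
  also have "1 / (1 + s * L + t * M) - 1 / (1 + s * L + t * L)
     = (t * L - t * M) / ((1 + s * L + t * M) * (1 + s * L + t * L))"
    using L by (simp add: diff_frac_eq)
  \<comment> \<open>Over the common denominator, dropping \<open>s * L\<close> from both factors
    only enlarges the fraction.\<close>
  also have "C * \<dots> \<le> C * ((t * L - t * M) / ((1 + t * M) * (1 + t * L)))"
    using L C by (intro mult_left_mono divide_left_mono mult_mono mult_pos_pos) auto
  also have "(t * L - t * M) / ((1 + t * M) * (1 + t * L)) = 1 / (1 + t * M) - 1 / (1 + t * L)"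
    using L by (simp add: diff_frac_eq)
  finally show ?thesis by (simp add: right_diff_distrib)
qed

text \<open>Expanding the product leaves \<open>C - D - X v + Y v\<close>, where \<open>C\<close>
  and \<open>D\<close> do not depend on \<open>v\<close>. At \<open>u\<close> the joint transform
  \<open>Y\<close> is explicit; at \<open>w\<close> it is controlled through the resolvent.\<close>

lemma cgauss_receive_comparison:
  fixes S :: "complex^'n^'n"
  assumes S: "hermitian S" and st: "0 \<le> s" "0 \<le> t"
    and u: "norm u = 1" "(S ** S) *v u = L *\<^sub>R u" and L: "\<And>x. x \<bullet> ((S ** S) *v x) \<le> L * (norm x)\<^sup>2"
    and w: "norm w = 1"
  defines "F \<equiv> \<lambda>v z. (1 - exp (- (s * (norm (S *v z))\<^sup>2))) * (1 - exp (- (t * (cmod (cdot (S *v v) z))\<^sup>2)))"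
  shows "(\<integral>z. F w z \<partial>cgauss) \<le> (\<integral>z. F u z \<partial>cgauss)"
proof -
  define C where "C = measure (cgauss :: (complex^'n) measure) UNIV"
  define D where "D = (\<integral>z. exp (- (s * (norm (S *v z))\<^sup>2)) \<partial>cgauss)"
  define X where "X v = (\<integral>z. exp (- (t * (cmod (cdot (S *v v) z))\<^sup>2)) \<partial>cgauss)" for v
  define Y where "Y v = (\<integral>z. exp (- (s * (norm (S *v z))\<^sup>2 + t * (cmod (cdot (S *v v) z))\<^sup>2)) \<partial>cgauss)" for v
  have nS: "(norm (S *v v))\<^sup>2 = v \<bullet> ((S ** S) *v v)" for v
    by (simp add: power2_norm_eq_inner matrix_vector_mul_assoc[symmetric] hermitian_inner[OF S])
  have nu: "(norm (S *v u))\<^sup>2 = L" unfolding nS using u by (simp add: norm_eq_1)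
  then have L0: "0 \<le> L" by (metis zero_le_power2)
  have sL: "0 \<le> s * L" using st L0 by simp
  have FX: "(\<integral>z. F v z \<partial>cgauss) = C - D - X v + Y v" for v
  proof -
    have int: "integrable cgauss (\<lambda>z. exp (- (f z)))"
      if [measurable]: "f \<in> borel_measurable borel" and "\<And>z. 0 \<le> f z" for f :: "complex^'n \<Rightarrow> real"
      using that by (intro integrable_cgauss_bounded[of _ 1]) auto
    have "(\<integral>z. F v z \<partial>cgauss) = (\<integral>z. 1 - exp (- (s * (norm (S *v z))\<^sup>2)) - exp (- (t * (cmod (cdot (S *v v) z))\<^sup>2))
       + exp (- (s * (norm (S *v z))\<^sup>2 + t * (cmod (cdot (S *v v) z))\<^sup>2)) \<partial>cgauss)"
      unfolding F_def by (intro Bochner_Integration.integral_cong) (auto simp: algebra_simps exp_add[symmetric])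
    also have "\<dots> = C - D - X v + Y v"
      unfolding C_def D_def X_def Y_def using st
      by (subst Bochner_Integration.integral_add Bochner_Integration.integral_diff, (intro Bochner_Integration.integrable_diff int integrable_cgauss_bounded[of "\<lambda>_. 1" 1]; simp?)+)+ simp
    finally show ?thesis .
  qed
  have X: "X v = C / (1 + t * (norm (S *v v))\<^sup>2)" for v
    unfolding X_def C_def by (rule cgauss_laplace_linear[OF st(2)])
  have D0: "0 \<le> D" unfolding D_def by simp
  have DC: "(1 + s * L) * D \<le> C"
  proof -
    \<comment> \<open>Cauchy-Schwarz replaces \<open>norm (S *v z)\<close> by the modulus of the
      component of \<open>S *v z\<close> along \<open>u\<close>, whose transform is
      explicit.\<close>
    have "D \<le> (\<integral>z. exp (- (s * (cmod (cdot (S *v u) z))\<^sup>2)) \<partial>cgauss)"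
      unfolding D_def
    proof (intro integral_mono integrable_cgauss_bounded[of _ 1])
      fix z
      have "cmod (cdot (S *v u) z) \<le> norm (S *v z)"
        using cmod_cdot_le[of u "S *v z"] u(1) by (simp add: hermitian_cdot[OF S])
      then show "exp (- (s * (norm (S *v z))\<^sup>2)) \<le> exp (- (s * (cmod (cdot (S *v u) z))\<^sup>2))"
        using st by (simp add: mult_left_mono power_mono)
    qed (use st in auto)
    also have "\<dots> = C / (1 + s * L)"
      unfolding C_def nu[symmetric] by (rule cgauss_laplace_linear[OF st(1)])
    finally show ?thesis using sL by (simp add: field_simps)
  qed
  have Yu: "Y u = D * (1 + s * L) / (1 + s * L + t * L)"
  proof -
    let ?a = "S *v u"
    \<comment> \<open>As \<open>u\<close> is an eigenvector, the resolvent acts on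
      \<open>S *v u\<close> as the scalar \<open>1 / (1 + s * L)\<close>.\<close>
    let ?b = "(1 / (1 + s * L)) *\<^sub>R ?a"
    have "S *v (S *v ?a) = L *\<^sub>R ?a"
      using u(2) by (metis cmatrix_vector_mult_scaleR matrix_vector_mul_assoc)
    then have "?b + s *\<^sub>R (S *v (S *v ?b)) = ((1 / (1 + s * L)) * (1 + s * L)) *\<^sub>R ?a"
      by (simp add: cmatrix_vector_mult_scaleR scaleR_add_left[symmetric] add_divide_distrib[symmetric] mult.commute)
    then have "?b + s *\<^sub>R (S *v (S *v ?b)) = ?a" using sL by simp
    from cgauss_laplace[OF S st this]
    have "(1 + t * (L / (1 + s * L))) * Y u = D"
      using nu by (simp add: Y_def D_def power2_norm_eq_inner)
    moreover have "1 + t * (L / (1 + s * L)) = (1 + s * L + t * L) / (1 + s * L)"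
      using sL by (simp add: field_simps)
    moreover have "0 < 1 + s * L + t * L" using sL st L0 by (simp add: add_pos_nonneg)
    ultimately show ?thesis using sL by (simp add: field_simps)
  qed
  obtain b where b: "b + s *\<^sub>R (S *v (S *v b)) = S *v w" using resolvent_exists[OF S st(1)] .
  define m where "m = (S *v w) \<bullet> b"
  have m: "(norm (S *v w))\<^sup>2 \<le> (1 + s * L) * m"
    unfolding m_def by (rule resolvent_lower_bound[OF S st(1) L b])
  have m0: "0 \<le> m" using m sL
    by (metis add_pos_nonneg order_trans zero_le_mult_iff zero_le_power2 zero_less_one not_less)
  have "(1 + t * m) * Y w = D"
    unfolding m_def Y_def D_def by (rule cgauss_laplace[OF S st b])
  moreover have "0 < 1 + t * m" using st m0 by (simp add: add_pos_nonneg)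
  ultimately have Yw: "Y w = D / (1 + t * m)" by (simp add: field_simps)
  have "(norm (S *v w))\<^sup>2 \<le> L" unfolding nS using L[of w] w by simp
  then have "D / (1 + t * m) - D * (1 + s * L) / (1 + s * L + t * L)
     \<le> C / (1 + t * (norm (S *v w))\<^sup>2) - C / (1 + t * L)"
    by (intro laplace_comparison st D0 m0 DC m) auto
  then show ?thesis unfolding FX X Yu Yw nu by simp
qed

subsection \<open>Comparison of ergodic rates\<close>

lemma relay_rate_nonneg:
  assumes "0 \<le> p" "0 \<le> q"
  shows "0 \<le> relay_rate p q"
proof -
  have "ln (1 + p + q) \<le> ln ((1 + p) * (1 + q))"
    using assms by (intro ln_mono) (auto simp: algebra_simps add_pos_nonneg)
  also have "\<dots> = ln (1 + p) + ln (1 + q)"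
    using assms by (intro ln_mult_pos) auto
  finally show ?thesis by (simp add: relay_rate_def)
qed

text \<open>The resulting quadratic bound in the first-hop vector makes the optimal rate
  integrable.\<close>

lemma relay_rate_le_right:
  assumes "0 \<le> p" "0 \<le> q"
  shows "relay_rate p q \<le> q"
proof -
  have "ln (1 + p) \<le> ln (1 + p + q)" using assms by simp
  moreover have "ln (1 + q) \<le> q" using assms by (intro ln_add_one_self_le_self)
  ultimately show ?thesis by (simp add: relay_rate_def)
qed

lemma borel_measurable_relay_rate [measurable (raw)]:
  assumes [measurable]: "f \<in> borel_measurable M" "g \<in> borel_measurable M"
  shows "(\<lambda>x. relay_rate (f x) (g x)) \<in> borel_measurable M"
  unfolding relay_rate_def by measurable

text \<open>By the integral representation and Tonelli, both sides are mixtures over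
  \<open>s\<close> with the same non-negative weight \<open>exp (- s) / s\<close>. Working in
  \<open>ennreal\<close> avoids integrability questions, as the weight is not integrable near
  \<open>0\<close>.\<close>

lemma nn_integral_relay_rate_mono:
  fixes p\<^sub>1 q\<^sub>1 p\<^sub>2 q\<^sub>2 :: "'a \<Rightarrow> real"
  assumes M: "sigma_finite_measure M"
    and meas: "p\<^sub>1 \<in> borel_measurable M" "q\<^sub>1 \<in> borel_measurable M"
      "p\<^sub>2 \<in> borel_measurable M" "q\<^sub>2 \<in> borel_measurable M"
    and nn: "\<And>x. 0 \<le> p\<^sub>1 x" "\<And>x. 0 \<le> q\<^sub>1 x" "\<And>x. 0 \<le> p\<^sub>2 x" "\<And>x. 0 \<le> q\<^sub>2 x"
    and le: "\<And>s. 0 \<le> s \<Longrightarrow>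
      (\<integral>\<^sup>+x. ennreal ((1 - exp (- (s * p\<^sub>1 x))) * (1 - exp (- (s * q\<^sub>1 x)))) \<partial>M)
      \<le> (\<integral>\<^sup>+x. ennreal ((1 - exp (- (s * p\<^sub>2 x))) * (1 - exp (- (s * q\<^sub>2 x)))) \<partial>M)"
  shows "(\<integral>\<^sup>+x. ennreal (relay_rate (p\<^sub>1 x) (q\<^sub>1 x)) \<partial>M) \<le> (\<integral>\<^sup>+x. ennreal (relay_rate (p\<^sub>2 x) (q\<^sub>2 x)) \<partial>M)"
proof -
  interpret sigma_finite_measure M by fact
  interpret P: pair_sigma_finite M "lborel :: real measure" ..
  have eq: "(\<integral>\<^sup>+x. ennreal (relay_rate (p x) (q x)) \<partial>M)
     = (\<integral>\<^sup>+s. ennreal (exp (- s) / s) * indicator {0..} s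
         * (\<integral>\<^sup>+x. ennreal ((1 - exp (- (s * p x))) * (1 - exp (- (s * q x)))) \<partial>M) \<partial>lborel)"
    if [measurable]: "p \<in> borel_measurable M" "q \<in> borel_measurable M"
      and nn: "\<And>x. 0 \<le> p x" "\<And>x. 0 \<le> q x" for p q :: "'a \<Rightarrow> real"
  proof -
    have "(\<integral>\<^sup>+x. ennreal (relay_rate (p x) (q x)) \<partial>M)
      = (\<integral>\<^sup>+x. (\<integral>\<^sup>+s. ennreal (rate_kernel (p x) (q x) s) * indicator {0..} s \<partial>lborel) \<partial>M)"
      by (simp add: nn_integral_rate_kernel nn)
    also have "\<dots> = (\<integral>\<^sup>+s. (\<integral>\<^sup>+x. ennreal (rate_kernel (p x) (q x) s) * indicator {0..} s \<partial>M) \<partial>lborel)"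
      unfolding rate_kernel_def by (rule P.Fubini'[symmetric]) measurable
    also have "\<dots> = (\<integral>\<^sup>+s. ennreal (exp (- s) / s) * indicator {0..} s
         * (\<integral>\<^sup>+x. ennreal ((1 - exp (- (s * p x))) * (1 - exp (- (s * q x)))) \<partial>M) \<partial>lborel)"
    proof (intro nn_integral_cong)
      fix s :: real
      show "(\<integral>\<^sup>+x. ennreal (rate_kernel (p x) (q x) s) * indicator {0..} s \<partial>M)
        = ennreal (exp (- s) / s) * indicator {0..} s
         * (\<integral>\<^sup>+x. ennreal ((1 - exp (- (s * p x))) * (1 - exp (- (s * q x)))) \<partial>M)"
      proof (cases "0 \<le> s")
        case True
        have "ennreal (rate_kernel (p x) (q x) s)
            = ennreal (exp (- s) / s) * ennreal ((1 - exp (- (s * p x))) * (1 - exp (- (s * q x))))" for x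
          unfolding rate_kernel_def using True nn by (intro ennreal_mult) auto
        then show ?thesis using True by (simp add: nn_integral_cmult)
      qed simp
    qed
    finally show ?thesis .
  qed
  show ?thesis
    unfolding eq[OF meas(1,2) nn(1,2)] eq[OF meas(3,4) nn(3,4)]
    by (intro nn_integral_mono) (auto intro!: mult_left_mono le split: split_indicator)
qed

lemma nn_integral_cgauss_eq_integral:
  fixes f :: "complex^'n \<Rightarrow> real"
  assumes "f \<in> borel_measurable borel" "\<And>z. 0 \<le> f z" "\<And>z. f z \<le> 1"
  shows "(\<integral>\<^sup>+z. ennreal (f z) \<partial>cgauss) = ennreal (\<integral>z. f z \<partial>cgauss)"
  using assms by (intro nn_integral_eq_integral integrable_cgauss_bounded[of _ 1]) auto

lemma one_minus_exp_mult_bounds: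
  fixes x y :: real
  assumes "0 \<le> x" "0 \<le> y"
  shows "0 \<le> (1 - exp (- x)) * (1 - exp (- y))" "(1 - exp (- x)) * (1 - exp (- y)) \<le> 1"
  using assms by (auto intro: mult_le_one)

text \<open>With \<open>q\<close> fixed, only one factor is averaged, and its mean
  \<open>C - C / (1 + s * \<beta> * (norm b)\<^sup>2)\<close> increases with
  \<open>norm b\<close>.\<close>

lemma cgauss_transmit_relay_rate_mono:
  fixes a a' :: "complex^'n"
  assumes "norm a \<le> norm a'" and pq: "0 \<le> \<beta>" "0 \<le> q"
  shows "(\<integral>\<^sup>+z. ennreal (relay_rate (\<beta> * (cmod (cdot a z))\<^sup>2) q) \<partial>cgauss)
    \<le> (\<integral>\<^sup>+z. ennreal (relay_rate (\<beta> * (cmod (cdot a' z))\<^sup>2) q) \<partial>cgauss)"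
proof (rule nn_integral_relay_rate_mono)
  show "sigma_finite_measure (cgauss :: (complex^'n) measure)" by unfold_locales
  fix s :: real assume s: "0 \<le> s"
  define C where "C = measure (cgauss :: (complex^'n) measure) UNIV"
  define k where "k = 1 - exp (- (s * q))"
  have k: "0 \<le> k" using s pq by (simp add: k_def)
  have eq: "(\<integral>\<^sup>+z. ennreal ((1 - exp (- (s * (\<beta> * (cmod (cdot b z))\<^sup>2)))) * k) \<partial>cgauss)
    = ennreal ((C - C / (1 + s * \<beta> * (norm b)\<^sup>2)) * k)" for b :: "complex^'n"
  proof -
    have "(\<integral>\<^sup>+z. ennreal ((1 - exp (- (s * (\<beta> * (cmod (cdot b z))\<^sup>2)))) * k) \<partial>cgauss)
      = ennreal (\<integral>z. (1 - exp (- (s * (\<beta> * (cmod (cdot b z))\<^sup>2)))) * k \<partial>cgauss)"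
      unfolding k_def using s pq
      by (intro nn_integral_cgauss_eq_integral one_minus_exp_mult_bounds) auto
    also have "(\<integral>z. (1 - exp (- (s * (\<beta> * (cmod (cdot b z))\<^sup>2)))) * k \<partial>cgauss)
      = (\<integral>z. 1 - exp (- (s * \<beta> * (cmod (cdot b z))\<^sup>2)) \<partial>cgauss) * k"
      by (simp add: mult.assoc)
    also have "(\<integral>z. 1 - exp (- (s * \<beta> * (cmod (cdot b z))\<^sup>2)) \<partial>cgauss)
      = (\<integral>z. 1 \<partial>(cgauss :: (complex^'n) measure)) - (\<integral>z. exp (- (s * \<beta> * (cmod (cdot b z))\<^sup>2)) \<partial>cgauss)"
      using s pq by (intro Bochner_Integration.integral_diff integrable_cgauss_bounded[of _ 1]) auto
    also have "\<dots> = C - C / (1 + s * \<beta> * (norm b)\<^sup>2)"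
      using s pq by (simp add: cgauss_laplace_linear C_def)
    finally show ?thesis .
  qed
  have "s * \<beta> * (norm a)\<^sup>2 \<le> s * \<beta> * (norm a')\<^sup>2"
    using assms s by (intro mult_left_mono power_mono) auto
  then have "C / (1 + s * \<beta> * (norm a')\<^sup>2) \<le> C / (1 + s * \<beta> * (norm a)\<^sup>2)"
    using s pq by (intro divide_left_mono mult_pos_pos) (auto simp: C_def add_pos_nonneg)
  then show "(\<integral>\<^sup>+z. ennreal ((1 - exp (- (s * (\<beta> * (cmod (cdot a z))\<^sup>2)))) * (1 - exp (- (s * q)))) \<partial>cgauss)
    \<le> (\<integral>\<^sup>+z. ennreal ((1 - exp (- (s * (\<beta> * (cmod (cdot a' z))\<^sup>2)))) * (1 - exp (- (s * q)))) \<partial>cgauss)"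
    unfolding k_def[symmetric] eq using k by (intro ennreal_leI mult_right_mono) auto
qed (use pq in auto)

lemma cgauss_receive_relay_rate_mono:
  fixes S :: "complex^'n^'n"
  assumes S: "hermitian S" and \<beta>\<gamma>: "0 \<le> \<beta>" "0 \<le> \<gamma>"
    and u: "norm u = 1" "(S ** S) *v u = L *\<^sub>R u" and L: "\<And>x. x \<bullet> ((S ** S) *v x) \<le> L * (norm x)\<^sup>2"
    and w: "norm w = 1"
  shows "(\<integral>\<^sup>+z. ennreal (relay_rate (\<beta> * (norm (S *v z))\<^sup>2) (\<gamma> * (cmod (cdot (S *v w) z))\<^sup>2)) \<partial>cgauss)
    \<le> (\<integral>\<^sup>+z. ennreal (relay_rate (\<beta> * (norm (S *v z))\<^sup>2) (\<gamma> * (cmod (cdot (S *v u) z))\<^sup>2)) \<partial>cgauss)"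
proof (rule nn_integral_relay_rate_mono)
  show "sigma_finite_measure (cgauss :: (complex^'n) measure)" by unfold_locales
  fix s :: real assume s: "0 \<le> s"
  have eq: "(\<integral>\<^sup>+z. ennreal ((1 - exp (- (s * (\<beta> * (norm (S *v z))\<^sup>2)))) * (1 - exp (- (s * (\<gamma> * (cmod (cdot (S *v v) z))\<^sup>2))))) \<partial>cgauss)
    = ennreal (\<integral>z. (1 - exp (- (s * \<beta> * (norm (S *v z))\<^sup>2))) * (1 - exp (- (s * \<gamma> * (cmod (cdot (S *v v) z))\<^sup>2))) \<partial>cgauss)" for v
    unfolding mult.assoc[symmetric] using s \<beta>\<gamma>
    by (intro nn_integral_cgauss_eq_integral one_minus_exp_mult_bounds) auto
  show "(\<integral>\<^sup>+z. ennreal ((1 - exp (- (s * (\<beta> * (norm (S *v z))\<^sup>2)))) * (1 - exp (- (s * (\<gamma> * (cmod (cdot (S *v w) z))\<^sup>2))))) \<partial>cgauss)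
    \<le> (\<integral>\<^sup>+z. ennreal ((1 - exp (- (s * (\<beta> * (norm (S *v z))\<^sup>2)))) * (1 - exp (- (s * (\<gamma> * (cmod (cdot (S *v u) z))\<^sup>2))))) \<partial>cgauss)"
    unfolding eq using s \<beta>\<gamma>
    by (intro ennreal_leI cgauss_receive_comparison[OF S _ _ u L w]) auto
qed (use \<beta>\<gamma> in auto)

text \<open>Half of the Gaussian exponent absorbs the square, through
  \<open>(norm z)\<^sup>2 \<le> 2 * exp ((norm z)\<^sup>2 / 2)\<close>.\<close>

lemma nn_integral_cgauss_power2_norm_finite:
  "(\<integral>\<^sup>+z. ennreal ((norm z)\<^sup>2) \<partial>(cgauss :: (complex^'n) measure)) < \<infinity>"
proof -
  have "(\<integral>\<^sup>+z. ennreal (exp (- (norm z)\<^sup>2)) * ennreal ((norm z)\<^sup>2) \<partial>(lborel :: (complex^'n) measure))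
    \<le> (\<integral>\<^sup>+z. ennreal 2 * ennreal (exp (- ((norm z)\<^sup>2 / 2))) \<partial>(lborel :: (complex^'n) measure))"
  proof (intro nn_integral_mono)
    fix z :: "complex^'n"
    have "(norm z)\<^sup>2 / 2 \<le> exp ((norm z)\<^sup>2 / 2)" using exp_ge_add_one_self[of "(norm z)\<^sup>2 / 2"] by linarith
    then have "exp (- (norm z)\<^sup>2) * (norm z)\<^sup>2 \<le> exp (- (norm z)\<^sup>2) * (2 * exp ((norm z)\<^sup>2 / 2))"
      by (intro mult_left_mono) auto
    also have "\<dots> = 2 * exp (- ((norm z)\<^sup>2 / 2))"
      by (simp add: mult.left_commute exp_add[symmetric])
    finally show "ennreal (exp (- (norm z)\<^sup>2)) * ennreal ((norm z)\<^sup>2) \<le> ennreal 2 * ennreal (exp (- ((norm z)\<^sup>2 / 2)))"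
      by (simp add: ennreal_mult[symmetric] ennreal_leI del: ennreal_numeral)
  qed
  also have "\<dots> = ennreal 2 * (\<integral>\<^sup>+z. ennreal (exp (- ((norm z)\<^sup>2 / 2))) \<partial>(lborel :: (complex^'n) measure))"
    by (intro nn_integral_cmult) auto
  also have "(\<integral>\<^sup>+z. ennreal (exp (- ((norm z)\<^sup>2 / 2))) \<partial>(lborel :: (complex^'n) measure)) < \<infinity>"
    using nn_integral_gauss_finite[where 'a="complex^'n"]
    by (subst nn_integral_lborel_scale[of _ "sqrt 2"]) (auto simp: power_mult_distrib ennreal_mult_less_top)
  then have "ennreal 2 * (\<integral>\<^sup>+z. ennreal (exp (- ((norm z)\<^sup>2 / 2))) \<partial>(lborel :: (complex^'n) measure)) < \<infinity>"
    by (simp add: ennreal_mult_less_top)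
  finally show ?thesis
    by (subst nn_integral_cgauss) (auto simp: ennreal_mult_less_top)
qed

section \<open>From the relay model to \<open>relay_rate\<close>, and the optimality theorem\<close>

lemma herm_vec_herm_vec [simp]: "herm_vec (herm_vec u) = u"
  by (simp add: herm_vec_def vec_eq_iff)

lemma norm_herm_vec [simp]: "norm (herm_vec u) = norm u"
  by (simp add: herm_vec_def norm_vec_def)

lemma rowcol_eq_cdot: "rowcol w h = cdot (herm_vec w) h"
  by (simp add: rowcol_def cdot_def herm_vec_def)

lemma rowcol_vector_matrix_mult: "rowcol (h v* A) w = cdot (herm_vec (A *v w)) h"
proof -
  have "rowcol (h v* A) w = (\<Sum>j\<in>UNIV. \<Sum>i\<in>UNIV. h $ i * A $ i $ j * w $ j)"
    by (simp add: rowcol_def vector_matrix_mult_def sum_distrib_right sum_distrib_left mult_ac)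
  also have "\<dots> = (\<Sum>i\<in>UNIV. \<Sum>j\<in>UNIV. h $ i * A $ i $ j * w $ j)"
    by (rule sum.swap)
  also have "\<dots> = cdot (herm_vec (A *v w)) h"
    by (simp add: cdot_def herm_vec_def matrix_vector_mult_def sum_distrib_right sum_distrib_left mult_ac)
  finally show ?thesis .
qed

lemma ln_one_plus_relay_snr:
  fixes p q :: real
  assumes "0 \<le> p" "0 \<le> q"
  shows "ln (1 + p * q / (p + q + 1)) = relay_rate p q"
proof -
  have "1 + p * q / (p + q + 1) = (1 + p) * (1 + q) / (1 + p + q)"
    using assms by (simp add: field_simps)
  then show ?thesis
    using assms by (simp add: relay_rate_def ln_div ln_mult_pos add_pos_nonneg)
qed

text \<open>Both products are rewritten as \<open>cdot\<close> of a fixed vector with the Gaussian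
  one, \<open>hpd_sqrt Rr\<close> moving across because it is Hermitian. The coefficient of the
  numerator is \<open>\<beta> * \<gamma>\<close>.\<close>

lemma log_one_plus_Gamma:
  fixes \<eta> \<theta> \<rho> d1 d2 \<tau> :: real
  assumes "0 < \<eta>" "0 < \<theta>" "\<theta> < 1" "0 < \<rho>" "0 < d1" "0 < d2"
    and Sr: "hermitian (hpd_sqrt Rr)"
  defines "\<beta> \<equiv> \<eta> * \<theta> * \<rho> / (d1 powr \<tau> * d2 powr \<tau>)" and "\<gamma> \<equiv> (1 - \<theta>) * \<rho> / d1 powr \<tau>"
  shows "log 2 (1 + Gamma \<eta> \<theta> \<rho> d1 d2 \<tau> Rr Rt wr wt x y)
    = relay_rate (\<beta> * (norm (hpd_sqrt Rr *v x))\<^sup>2 * (cmod (cdot (herm_vec (hpd_sqrt Rt *v wt)) y))\<^sup>2)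
        (\<gamma> * (cmod (cdot (hpd_sqrt Rr *v herm_vec wr) x))\<^sup>2) / ln 2"
proof -
  let ?A = "(norm (hpd_sqrt Rr *v x))\<^sup>2" and ?G = "(cmod (cdot (herm_vec (hpd_sqrt Rt *v wt)) y))\<^sup>2"
  let ?B = "(cmod (cdot (hpd_sqrt Rr *v herm_vec wr) x))\<^sup>2"
  have pos: "0 \<le> \<beta>" "0 \<le> \<gamma>" using assms by (auto simp: \<beta>_def \<gamma>_def)
  have "d1 powr (2 * \<tau>) = d1 powr \<tau> * d1 powr \<tau>" by (simp add: powr_add[symmetric])
  then have \<beta>\<gamma>: "\<eta> * \<theta> * (1 - \<theta>) * \<rho>^2 / (d1 powr (2 * \<tau>) * d2 powr \<tau>) = \<beta> * \<gamma>"
    by (simp add: \<beta>_def \<gamma>_def power2_eq_square mult_ac)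
  have "Gamma \<eta> \<theta> \<rho> d1 d2 \<tau> Rr Rt wr wt x y = \<beta> * \<gamma> * ?A * ?B * ?G / (\<beta> * ?A * ?G + \<gamma> * ?B + 1)"
    unfolding Gamma_def Let_def \<beta>\<gamma> \<beta>_def[symmetric] \<gamma>_def[symmetric] rowcol_vector_matrix_mult
    unfolding rowcol_eq_cdot hermitian_cdot[OF Sr] by simp
  also have "\<dots> = (\<beta> * ?A * ?G) * (\<gamma> * ?B) / (\<beta> * ?A * ?G + \<gamma> * ?B + 1)"
    by (simp add: mult_ac)
  finally show ?thesis
    using ln_one_plus_relay_snr[of "\<beta> * ?A * ?G" "\<gamma> * ?B"] pos by (simp add: log_def)
qed

theorem theorem1:
  fixes \<eta> \<theta> \<rho> d1 d2 \<tau> :: real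
    and Rr Rt :: "complex^'n^'n"
    and ur ut :: "complex^'n"
  assumes "0 < \<eta>" "\<eta> \<le> 1" "0 < \<theta>" "\<theta> < 1" "0 < \<rho>" "0 < d1" "0 < d2" "0 < \<tau>"
    and "hermitian_posdef Rr" "hermitian_posdef Rt"
    and "unit_top_eigvec Rt ut" "unit_top_eigvec Rr ur"
  shows "norm (herm_vec ur) = 1 \<and>
         (\<forall>wr wt :: complex^'n. norm wr = 1 \<longrightarrow> norm wt = 1 \<longrightarrow>
            ergodic_capacity \<eta> \<theta> \<rho> d1 d2 \<tau> Rr Rt wr wt
              \<le> ergodic_capacity \<eta> \<theta> \<rho> d1 d2 \<tau> Rr Rt (herm_vec ur) ut)"
proof (intro conjI allI impI)
  have nur: "norm ur = 1" and nut: "norm ut = 1" using assms by (auto simp: unit_top_eigvec_def)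
  then show "norm (herm_vec ur) = 1" by simp
  fix wr wt :: "complex^'n"
  assume wr: "norm wr = 1" and wt: "norm wt = 1"
  define Sr where "Sr = hpd_sqrt Rr"
  define St where "St = hpd_sqrt Rt"
  have Sr: "hermitian Sr" "Sr ** Sr = Rr" and St: "hermitian St" "St ** St = Rt"
    using assms hpd_sqrt_props by (auto simp: Sr_def St_def)
  have hR: "hermitian Rr" "hermitian Rt" using assms by (auto simp: hermitian_posdef_iff)
  obtain L where L: "Rr *v ur = L *\<^sub>R ur" "\<And>x. x \<bullet> (Rr *v x) \<le> L * (norm x)\<^sup>2"
    using unit_top_eigvecE[OF hR(1) assms(12)] by blast
  obtain \<sigma> where \<sigma>: "Rt *v ut = \<sigma> *\<^sub>R ut" "\<And>x. x \<bullet> (Rt *v x) \<le> \<sigma> * (norm x)\<^sup>2"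
    using unit_top_eigvecE[OF hR(2) assms(11)] by blast
  define \<beta> where "\<beta> = \<eta> * \<theta> * \<rho> / (d1 powr \<tau> * d2 powr \<tau>)"
  define \<gamma> where "\<gamma> = (1 - \<theta>) * \<rho> / d1 powr \<tau>"
  have pos: "0 \<le> \<beta>" "0 \<le> \<gamma>" using assms by (auto simp: \<beta>_def \<gamma>_def)
  define p where "p v x y = \<beta> * (norm (Sr *v x))\<^sup>2 * (cmod (cdot (herm_vec (St *v v)) y))\<^sup>2" for v x y
  define q where "q w x = \<gamma> * (cmod (cdot (Sr *v w) x))\<^sup>2" for w x
  have pq: "0 \<le> p v x y" "0 \<le> q w x" for v w x y using pos by (auto simp: p_def q_def)
  \<comment> \<open>The unscaled rate as an extended non-negative integral; its first argument is
    the column vector \<open>herm_vec wr\<close> rather than \<open>wr\<close>.\<close>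
  define N where "N w v = (\<integral>\<^sup>+h. ennreal (relay_rate (p v (fst h) (snd h)) (q w (fst h))) \<partial>(cgauss \<Otimes>\<^sub>M cgauss))" for w v
  interpret P: pair_sigma_finite "cgauss :: (complex^'n) measure" "cgauss :: (complex^'n) measure" ..
  have meas [measurable]:
    "(\<lambda>h. relay_rate (p v (fst h) (snd h)) (q w (fst h))) \<in> borel_measurable (cgauss \<Otimes>\<^sub>M cgauss)" for w v
    unfolding p_def q_def by measurable
  \<comment> \<open>Two orders of integration: \<open>N1\<close> has the second hop inside, for
    changing the transmit vector, and \<open>N2\<close> the first hop, for changing the receive
    vector.\<close>
  have N1: "N w v = (\<integral>\<^sup>+x. (\<integral>\<^sup>+y. ennreal (relay_rate (p v x y) (q w x)) \<partial>cgauss) \<partial>cgauss)" for w v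
    unfolding N_def by (subst cgauss.nn_integral_fst[symmetric]) auto
  have N2: "N w v = (\<integral>\<^sup>+y. (\<integral>\<^sup>+x. ennreal (relay_rate (p v x y) (q w x)) \<partial>cgauss) \<partial>cgauss)" for w v
    unfolding N_def by (subst P.nn_integral_snd[symmetric]) (auto simp: split_beta')
  have cap: "ergodic_capacity \<eta> \<theta> \<rho> d1 d2 \<tau> Rr Rt w v = 1 / 2 * (enn2real (N (herm_vec w) v) / ln 2)" for w v
  proof -
    have "log 2 (1 + Gamma \<eta> \<theta> \<rho> d1 d2 \<tau> Rr Rt w v x y) = relay_rate (p v x y) (q (herm_vec w) x) / ln 2" for x y
      unfolding p_def q_def \<beta>_def \<gamma>_def Sr_def St_def
      using assms Sr(1) by (intro log_one_plus_Gamma) (auto simp: Sr_def)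
    then show ?thesis
      unfolding ergodic_capacity_def N_def
      by (simp add: integral_eq_nn_integral relay_rate_nonneg pq)
  qed
  have "N (herm_vec wr) wt \<le> N (herm_vec wr) ut"
    unfolding N1
  proof (rule nn_integral_mono)
    fix x :: "complex^'n"
    have nS: "(norm (St *v v))\<^sup>2 = v \<bullet> (Rt *v v)" for v
      by (simp add: power2_norm_eq_inner St(2)[symmetric] matrix_vector_mul_assoc[symmetric] hermitian_inner[OF St(1)])
    \<comment> \<open>The squared norm is the form of \<open>Rt\<close>, at most
      \<open>\<sigma>\<close> on unit vectors and equal to \<open>\<sigma>\<close> at
      \<open>ut\<close>.\<close>
    have "(norm (St *v wt))\<^sup>2 \<le> (norm (St *v ut))\<^sup>2"
      unfolding nS using \<sigma>(1) \<sigma>(2)[of wt] wt nut by (simp add: norm_eq_1)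
    then have "norm (herm_vec (St *v wt)) \<le> norm (herm_vec (St *v ut))"
      by (simp add: power2_le_iff_abs_le)
    then show "(\<integral>\<^sup>+y. ennreal (relay_rate (p wt x y) (q (herm_vec wr) x)) \<partial>cgauss)
      \<le> (\<integral>\<^sup>+y. ennreal (relay_rate (p ut x y) (q (herm_vec wr) x)) \<partial>cgauss)"
      unfolding p_def using pos pq by (intro cgauss_transmit_relay_rate_mono) auto
  qed
  also have "\<dots> \<le> N ur ut"
    unfolding N2
  proof (rule nn_integral_mono)
    fix y :: "complex^'n"
    \<comment> \<open>For fixed \<open>y\<close> the gain of \<open>ut\<close> is a constant,
      absorbed into the factor of the squared norm.\<close>
    let ?b = "\<beta> * (cmod (cdot (herm_vec (St *v ut)) y))\<^sup>2"
    have p': "p ut x y = ?b * (norm (Sr *v x))\<^sup>2" for x by (simp add: p_def)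
    show "(\<integral>\<^sup>+x. ennreal (relay_rate (p ut x y) (q (herm_vec wr) x)) \<partial>cgauss)
      \<le> (\<integral>\<^sup>+x. ennreal (relay_rate (p ut x y) (q ur x)) \<partial>cgauss)"
      unfolding p' q_def
      by (rule cgauss_receive_relay_rate_mono[OF Sr(1) _ _ nur, of _ _ L]) (use pos L wr in \<open>simp_all add: Sr(2)\<close>)
  qed
  finally have le: "N (herm_vec wr) wt \<le> N ur ut" .
  \<comment> \<open>\<open>enn2real\<close> sends infinity to \<open>0\<close>, so passing
    \<open>le\<close> to the capacities requires the larger value to be finite.\<close>
  have fin: "N ur ut < \<infinity>"
  proof -
    let ?K = "\<gamma> * (norm (Sr *v ur))\<^sup>2" and ?C = "emeasure (cgauss :: (complex^'n) measure) UNIV"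
    have "N ur ut \<le> (\<integral>\<^sup>+x. (\<integral>\<^sup>+y. ennreal (?K * (norm (x::complex^'n))\<^sup>2) \<partial>(cgauss :: (complex^'n) measure)) \<partial>cgauss)"
      unfolding N1
    proof (intro nn_integral_mono ennreal_leI)
      fix x y :: "complex^'n"
      have "relay_rate (p ut x y) (q ur x) \<le> q ur x" by (intro relay_rate_le_right pq)
      also have "\<dots> \<le> \<gamma> * (norm (Sr *v ur) * norm x)\<^sup>2"
        unfolding q_def using pos by (intro mult_left_mono power_mono cmod_cdot_le) auto
      finally show "relay_rate (p ut x y) (q ur x) \<le> ?K * (norm x)\<^sup>2" by (simp add: power_mult_distrib mult.assoc)
    qed
    also have "\<dots> = (\<integral>\<^sup>+x. (ennreal ?K * ?C) * ennreal ((norm (x::complex^'n))\<^sup>2) \<partial>cgauss)"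
      using pos by (intro nn_integral_cong) (simp add: ennreal_mult mult_ac)
    also have "\<dots> = (ennreal ?K * ?C) * (\<integral>\<^sup>+x. ennreal ((norm (x::complex^'n))\<^sup>2) \<partial>cgauss)"
      by (rule nn_integral_cmult) simp
    also have "\<dots> < \<infinity>"
    proof -
      have "?C < \<top>"
        using finite_measure.emeasure_finite[OF finite_measure_cgauss[where 'n='n], of UNIV]
        by (simp only: infinity_ennreal_def less_top)
      then show ?thesis
        using nn_integral_cgauss_power2_norm_finite[where 'n='n] by (simp add: ennreal_mult_less_top)
    qed
    finally show ?thesis .
  qed
  show "ergodic_capacity \<eta> \<theta> \<rho> d1 d2 \<tau> Rr Rt wr wt
      \<le> ergodic_capacity \<eta> \<theta> \<rho> d1 d2 \<tau> Rr Rt (herm_vec ur) ut"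
    unfolding cap using enn2real_mono[OF le] fin by (simp add: divide_right_mono)
qed

end
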